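(* For every finite tree $T$ with $n$ vertices, $$F_T(x,y)=\sum_{i=1}^{n}\sum_{j=0}^{n-i}x^iy^j\sum_{\lambda\vdash n}\sigma(\lambda,i,j)\,c_\lambda(T),$$ where $F_T(x,y)=\sum_{H}x^{|V(H)|}y^{d(V(H))}$ (sum over all subtrees $H$ of $T$), $c_\lambda(T)$ is the coefficient of $p_\lambda$ in the power-sum expansion of the chromatic symmetric function $X_T$, and $$\sigma(\lambda,i,j)=(-1)^{n-j-1}\binom{n-i-l(\lambda)+1}{j-l(\lambda)+1}\left(\sum_{s=1}^{l(\lambda)}\delta(\lambda_s,i)\right).$$
   Context: A partition $\lambda\vdash n$ is a sequence $\lambda=(\lambda_1,\dots,\lambda_l)$ of positive integers with $\lambda_1\ge\dots\ge\lambda_l$ and $\sum_i\lambda_i=n$; $l(\lambda)=l$ is its number of parts. Here $\delta(a,b)=1$ if $a=b$ and $0$ otherwise, so $\sum_{s}\delta(\lambda_s,i)$ is the number of parts of $\lambda$ equal to $i$. A binomial coefficient $\binom{a}{b}$ with $b<0$ is $0$. (If $\lambda$ has no part equal to $i$ then $\sigma(\lambda,i,j)=0$; if it has one, then $n-i-l(\lambda)+1\ge 0$.) Subtrees of $T$ are nonempty connected subgraphs of $T$ (single vertices included). For $W\subseteq V(T)$, $d(W)$ denotes the number of edges of $T$ with exactly one endpoint in $W$. The chromatic symmetric function of a graph $G$ is $X_G=\sum_{\kappa}\prod_{v\in V(G)}x_{\kappa(v)}$, in commuting variables $x_1,x_2,\dots$, the sum being over all proper colorings $\kappa:V(G)\to\mathbb{Z}^+$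 of $G$. It is a symmetric function homogeneous of degree $|V(G)|$. With $p_k=\sum_{i\ge1}x_i^k$ and $p_\lambda=p_{\lambda_1}\cdots p_{\lambda_l}$, the set $\{p_\lambda:\lambda\vdash n\}$ is a basis of the $\mathbb{Q}$-vector space of symmetric functions homogeneous of degree $n$, and the rational numbers $c_\lambda(G)$ are defined by $X_G=\sum_{\lambda\vdash n}c_\lambda(G)p_\lambda$ with $n=|V(G)|$. *)

theory Defs
  imports "HOL-Library.FuncSet" "HOL-Library.Multiset"
    "HOL-Computational_Algebra.Polynomial" Complex_Main
begin

section \<open>Formal power series in arbitrarily many commuting variables\<close>

text \<open>
  A monomial is the finite multiset of its variables, and a power series is its family of
  coefficients. Series of bounded degree in infinitely many variables, such as symmetric
  functions, are elements of this ring.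
\<close>

typedef ('v, 'a) mfps = "UNIV :: ('v multiset \<Rightarrow> 'a) set"
  morphisms mfps_coeff Abs_mfps ..

declare Abs_mfps_inverse[OF UNIV_I, simp]

lemma mfps_eqI: "(\<And>m. mfps_coeff f m = mfps_coeff g m) \<Longrightarrow> f = g"
  by (metis ext mfps_coeff_inject)

lemma finite_submultisets: "finite {a. a \<subseteq># (m :: 'v multiset)}"
proof (induction m)
  case empty
  then show ?case by simp
next
  case (add x m)
  have "{a. a \<subseteq># add_mset x m} \<subseteq> {a. a \<subseteq># m} \<union> add_mset x ` {a. a \<subseteq># m}"
  proof
    fix a assume "a \<in> {a. a \<subseteq># add_mset x m}"
    hence a: "a \<subseteq># add_mset x m" by simp
    show "a \<in> {a. a \<subseteq># m} \<union> add_mset x ` {a. a \<subseteq># m}"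
    proof (cases "x \<in># a")
      case True
      then obtain b where "a = add_mset x b" by (meson multi_member_split)
      with a show ?thesis by auto
    next
      case False
      with a have "a \<subseteq># m"
        by (metis add_mset_remove_trivial diff_single_trivial subset_eq_diff_conv
            add_mset_add_single)
      then show ?thesis by simp
    qed
  qed
  with add show ?case by (meson finite_UnI finite_imageI finite_subset)
qed

instantiation mfps :: (type, comm_ring_1) comm_ring_1
begin

definition "0 = Abs_mfps (\<lambda>_. 0)"

definition "1 = Abs_mfps (\<lambda>m. if m = {#} then 1 else 0)"

definition "f + g = Abs_mfps (\<lambda>m. mfps_coeff f m + mfps_coeff g m)"

definition "f - g = Abs_mfps (\<lambda>m. mfps_coeff f m - mfps_coeff g m)"

definition "- f = Abs_mfps (\<lambda>m. - mfps_coeff f m)"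

definition "f * g = Abs_mfps (\<lambda>m. \<Sum>a | a \<subseteq># m. mfps_coeff f a * mfps_coeff g (m - a))"

instance
proof
  fix f g h :: "('a, 'b) mfps"
  show "f * g * h = f * (g * h)"
  proof (rule mfps_eqI)
    fix m :: "'a multiset"
    let ?F = "mfps_coeff f" and ?G = "mfps_coeff g" and ?H = "mfps_coeff h"
    have "mfps_coeff (f * g * h) m
        = (\<Sum>a | a \<subseteq># m. \<Sum>b | b \<subseteq># a. ?F b * ?G (a - b) * ?H (m - a))"
      by (simp add: times_mfps_def sum_distrib_right)
    also have "\<dots> = (\<Sum>(a, b)\<in>(SIGMA a:{a. a \<subseteq># m}. {b. b \<subseteq># a}).
        ?F b * ?G (a - b) * ?H (m - a))"
      by (rule sum.Sigma) (auto simp: finite_submultisets)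
    also have "\<dots> = (\<Sum>(b, c)\<in>(SIGMA b:{b. b \<subseteq># m}. {c. c \<subseteq># m - b}).
        ?F b * (?G c * ?H (m - b - c)))"
      by (rule sum.reindex_bij_witness[of _ "\<lambda>(b, c). (b + c, b)" "\<lambda>(a, b). (b, a - b)"])
        (auto simp: mult.assoc subset_eq_diff_conv subset_mset.le_diff_conv2 add.commute
          intro: subset_mset.order_trans)
    also have "\<dots> = (\<Sum>b | b \<subseteq># m. \<Sum>c | c \<subseteq># m - b. ?F b * (?G c * ?H (m - b - c)))"
      by (rule sum.Sigma[symmetric]) (auto simp: finite_submultisets)
    also have "\<dots> = mfps_coeff (f * (g * h)) m"
      by (simp add: times_mfps_def sum_distrib_left)
    finally show "mfps_coeff (f * g * h) m = mfps_coeff (f * (g * h)) m" .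
  qed
  show "f * g = g * f"
  proof (rule mfps_eqI)
    fix m :: "'a multiset"
    have *: "m - (m - a) = a" if "a \<subseteq># m" for a
      using that by (auto simp: multiset_eq_iff subseteq_mset_def)
    show "mfps_coeff (f * g) m = mfps_coeff (g * f) m"
      unfolding times_mfps_def
      by simp (rule sum.reindex_bij_witness[of _ "\<lambda>a. m - a" "\<lambda>a. m - a"];
        simp add: mult.commute *)
  qed
  show "1 * f = f"
  proof (rule mfps_eqI)
    fix m :: "'a multiset"
    have "mfps_coeff (1 * f) m = (\<Sum>a | a \<subseteq># m. if a = {#} then mfps_coeff f (m - a) else 0)"
      unfolding times_mfps_def one_mfps_def by (auto intro!: sum.cong)
    also have "\<dots> = mfps_coeff f m"
      by (simp add: sum.delta finite_submultisets)
    finally show "mfps_coeff (1 * f) m = mfps_coeff f m" .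
  qed
  show "(0 :: ('a, 'b) mfps) \<noteq> 1"
    unfolding zero_mfps_def one_mfps_def
    by (metis (mono_tags) Abs_mfps_inverse UNIV_I zero_neq_one)
qed (auto intro!: mfps_eqI simp: plus_mfps_def zero_mfps_def uminus_mfps_def minus_mfps_def
    times_mfps_def sum.distrib algebra_simps)

end

definition mfps_const :: "'a \<Rightarrow> ('v, 'a::comm_ring_1) mfps" where
  "mfps_const c = Abs_mfps (\<lambda>m. if m = {#} then c else 0)"

text \<open>
  The formal sum of the monomials \<open>mon a\<close> over \<open>a \<in> A\<close>. The index set may be infinite, as long
  as every monomial occurs for only finitely many indices.
\<close>

definition mfps_monom_sum :: "'i set \<Rightarrow> ('i \<Rightarrow> 'v multiset) \<Rightarrow> ('v, 'a::comm_ring_1) mfps" where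
  "mfps_monom_sum A mon = Abs_mfps (\<lambda>m. of_nat (card {a \<in> A. mon a = m}))"


section \<open>Partitions and power sums\<close>

definition partitions :: "nat \<Rightarrow> nat list set" where
  "partitions n = {lam. sorted_wrt (\<ge>) lam \<and> (\<forall>k\<in>set lam. 0 < k) \<and> sum_list lam = n}"

lemma finite_partitions: "finite (partitions n)"
proof -
  have *: "length xs \<le> sum_list xs" if "\<forall>k\<in>set xs. 0 < k" for xs :: "nat list"
    using that by (induction xs) (auto simp: Suc_le_eq add_less_le_mono)
  have "partitions n \<subseteq> {xs. set xs \<subseteq> {..n} \<and> length xs \<le> n}"
    using * by (auto simp: partitions_def member_le_sum_list)
  then show ?thesis
    by (rule finite_subset) (simp add: finite_lists_length_le)
qed

text \<open>The variables are \<open>x\<^sub>1, x\<^sub>2, \<dots>\<close>; the index 0 is not used.\<close>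

definition power_sum :: "nat \<Rightarrow> (nat, rat) mfps" where
  "power_sum k = mfps_monom_sum {1..} (\<lambda>i. replicate_mset k i)"

definition power_sum_part :: "nat list \<Rightarrow> (nat, rat) mfps" where
  "power_sum_part lam = prod_list (map power_sum lam)"

text \<open>
  Coefficients in the basis \<open>{p\<^sub>\<lambda> : \<lambda> \<turnstile> n}\<close> of the symmetric functions that are homogeneous of
  degree \<open>n\<close>. The values off the partitions of \<open>n\<close> are set to 0 only to make the function unique.
\<close>

definition power_sum_coeffs :: "nat \<Rightarrow> (nat, rat) mfps \<Rightarrow> nat list \<Rightarrow> rat" where
  "power_sum_coeffs n f = (THE c. (\<forall>lam. lam \<notin> partitions n \<longrightarrow> c lam = 0) \<and>
     f = (\<Sum>lam\<in>partitions n. mfps_const (c lam) * power_sum_part lam))"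


section \<open>Finite simple graphs and trees\<close>

type_synonym 'v graph = "'v set \<times> 'v set set"

abbreviation verts :: "'v graph \<Rightarrow> 'v set" where "verts \<equiv> fst"

abbreviation edges :: "'v graph \<Rightarrow> 'v set set" where "edges \<equiv> snd"

definition finite_graph :: "'v graph \<Rightarrow> bool" where
  "finite_graph G \<longleftrightarrow> finite (verts G) \<and> (\<forall>e\<in>edges G. e \<subseteq> verts G \<and> card e = 2)"

definition connected_graph :: "'v graph \<Rightarrow> bool" where
  "connected_graph G \<longleftrightarrow> verts G \<noteq> {} \<and>
     (\<forall>u\<in>verts G. \<forall>v\<in>verts G. (u, v) \<in> {(a, b). {a, b} \<in> edges G}\<^sup>*)"

definition graph_cycle :: "'v graph \<Rightarrow> 'v list \<Rightarrow> bool" where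
  "graph_cycle G vs \<longleftrightarrow> length vs \<ge> 3 \<and> distinct vs \<and>
     (\<forall>i<length vs. {vs ! i, vs ! (Suc i mod length vs)} \<in> edges G)"

definition finite_tree :: "'v graph \<Rightarrow> bool" where
  "finite_tree T \<longleftrightarrow> finite_graph T \<and> connected_graph T \<and> \<not> (\<exists>vs. graph_cycle T vs)"

definition subgraph :: "'v graph \<Rightarrow> 'v graph \<Rightarrow> bool" where
  "subgraph H G \<longleftrightarrow> finite_graph H \<and> verts H \<subseteq> verts G \<and> edges H \<subseteq> edges G"

definition subtrees :: "'v graph \<Rightarrow> 'v graph set" where
  "subtrees T = {H. subgraph H T \<and> connected_graph H}"

definition boundary_degree :: "'v graph \<Rightarrow> 'v set \<Rightarrow> nat" where
  "boundary_degree G W = card {e \<in> edges G. card (e \<inter> W) = 1}"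


section \<open>The chromatic symmetric function\<close>

definition proper_colorings :: "'v graph \<Rightarrow> ('v \<Rightarrow> nat) set" where
  "proper_colorings G = {kap \<in> verts G \<rightarrow>\<^sub>E {1..}.
     \<forall>u v. {u, v} \<in> edges G \<longrightarrow> kap u \<noteq> kap v}"

definition chromatic_symmetric_function :: "'v graph \<Rightarrow> (nat, rat) mfps" where
  "chromatic_symmetric_function G =
     mfps_monom_sum (proper_colorings G) (\<lambda>kap. image_mset kap (mset_set (verts G)))"

definition chrom_coeff :: "'v graph \<Rightarrow> nat list \<Rightarrow> rat" where
  "chrom_coeff G = power_sum_coeffs (card (verts G)) (chromatic_symmetric_function G)"


section \<open>The subtree polynomial and the coefficients \<open>\<sigma>\<close>\<close>

text \<open>
  Polynomials in \<open>x\<close> and \<open>y\<close> are polynomials in \<open>x\<close> whose coefficients are polynomials in \<open>y\<close>.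
\<close>

abbreviation poly_x :: "rat poly poly" where "poly_x \<equiv> [:0, 1:]"

abbreviation poly_y :: "rat poly poly" where "poly_y \<equiv> [:[:0, 1:]:]"

abbreviation poly_const :: "rat \<Rightarrow> rat poly poly" where "poly_const c \<equiv> [:[:c:]:]"

definition subtree_poly :: "'v graph \<Rightarrow> rat poly poly" where
  "subtree_poly T =
     (\<Sum>H\<in>subtrees T. poly_x ^ card (verts H) * poly_y ^ boundary_degree T (verts H))"

text \<open>
  Both arguments of the binomial coefficient in \<open>\<sigma>\<close> can be negative integers, so
  it must not be computed with truncating subtraction on \<open>nat\<close>. The value for a negative upper
  argument is irrelevant: for \<open>\<lambda> \<turnstile> n\<close>, \<open>n - i - l(\<lambda>) + 1 \<ge> 0\<close> as soon as \<open>\<lambda>\<close> has a part \<open>i\<close>.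
\<close>

definition int_binomial :: "int \<Rightarrow> int \<Rightarrow> rat" where
  "int_binomial a b = (if b < 0 then 0 else of_int a gchoose nat b)"

definition sigma_coeff :: "nat \<Rightarrow> nat list \<Rightarrow> nat \<Rightarrow> nat \<Rightarrow> rat" where
  "sigma_coeff n lam i j =
     (-1) powi (int n - int j - 1)
     * int_binomial (int n - int i - int (length lam) + 1) (int j - int (length lam) + 1)
     * (\<Sum>s<length lam. if lam ! s = i then 1 else 0)"

end

theory Submission
  imports Defs
begin

text \<open>
  Inclusion-exclusion over the monochromatic edges gives
  \<open>X\<^sub>T = \<Sum>S\<subseteq>E(T). (-1)^|S| p\<^bsub>\<lambda>(S)\<^esub>\<close>, where \<open>\<lambda>(S)\<close> lists the component sizes of \<open>(V(T), S)\<close>; since the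
  \<open>p\<^sub>\<lambda>\<close> are linearly independent, \<open>c\<^sub>\<lambda>(T)\<close> is the sum of \<open>(-1)^|S|\<close> over the \<open>S\<close> with \<open>\<lambda>(S) = \<lambda>\<close>.
  As \<open>\<sigma>(\<lambda>(S),i,j)\<close> counts the components of size \<open>i\<close>, the sum over \<open>\<lambda>\<close> becomes a sum over pairs of
  an edge set \<open>S\<close> and a component of size \<open>i\<close>, that is, over subtrees \<open>H\<close> with \<open>i\<close> vertices and sets
  \<open>S = E(H) \<union> F\<close> where \<open>F\<close> avoids \<open>E(H)\<close> and the boundary edges of \<open>H\<close>. There are \<open>N = n-i-d(V(H))\<close>
  edges available for \<open>F\<close>, a forest has \<open>l(\<lambda>(S)) = n-|S|\<close> components, and with \<open>r = n-i-j\<close> the sum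
  over \<open>F\<close> is \<open>\<Sum>F. (-1)^(|F|+r) (|F| choose r)\<close>, which is 1 if \<open>N = r\<close>, i.e. \<open>d(V(H)) = j\<close>, and 0
  otherwise.
\<close>

section \<open>Alternating sums over subsets\<close>

lemma sum_Pow_insert:
  assumes "finite M" "x \<notin> M"
  shows "(\<Sum>F\<in>Pow (insert x M). f F) = (\<Sum>F\<in>Pow M. f F) + (\<Sum>F\<in>Pow M. f (insert x F))"
proof -
  have "inj_on (insert x) (Pow M)"
    using assms(2) by (auto simp: inj_on_def)
  then show ?thesis
    using assms by (subst Pow_insert, subst sum.union_disjoint)
      (auto simp: sum.reindex)
qed

text \<open>This is the coefficient of \<open>t^r\<close> in
  \<open>(1 - (1 + t))^card M = (- t)^card M\<close>. In the induction, the subsets with and without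
  \<open>x\<close> combine by Pascal's rule into minus the sum over \<open>M\<close> for
  \<open>r - 1\<close>, so \<open>r\<close> has to be arbitrary.\<close>

lemma alternating_sum_choose_card:
  assumes "finite M"
  shows "(\<Sum>F\<in>Pow M. (- 1) ^ card F * of_nat (card F choose r)) =
    (if card M = r then (- 1) ^ r else 0 :: 'a :: comm_ring_1)"
  using assms
proof (induction M arbitrary: r)
  case empty
  then show ?case by (cases r) auto
next
  case (insert x M)
  have card: "card (insert x F) = Suc (card F)" if "F \<subseteq> M" for F
    using that insert.hyps finite_subset by (subst card_insert_disjoint) auto
  have "(\<Sum>F\<in>Pow M. (- 1) ^ card (insert x F) * of_nat (card (insert x F) choose r) :: 'a) =
      - (\<Sum>F\<in>Pow M. (- 1) ^ card F * of_nat (Suc (card F) choose r))"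
    by (simp add: sum_negf [symmetric] card)
  then have "(\<Sum>F\<in>Pow (insert x M). (- 1) ^ card F * of_nat (card F choose r) :: 'a) =
      (\<Sum>F\<in>Pow M. (- 1) ^ card F * (of_nat (card F choose r) - of_nat (Suc (card F) choose r)))"
    using insert.hyps
    by (simp add: sum_Pow_insert right_diff_distrib sum_subtractf)
  also have "\<dots> = (if card (insert x M) = r then (- 1) ^ r else 0)"
  proof (cases r)
    case 0
    then show ?thesis using insert.hyps by simp
  next
    case (Suc r')
    have "(\<Sum>F\<in>Pow M. (- 1) ^ card F * (of_nat (card F choose r) - of_nat (Suc (card F) choose r))) =
        - (\<Sum>F\<in>Pow M. (- 1) ^ card F * of_nat (card F choose r') :: 'a)"
      by (simp add: Suc sum_negf algebra_simps)
    then show ?thesis using insert Suc by simp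
  qed
  finally show ?case .
qed

lemma alternating_sum_Pow:
  "finite M \<Longrightarrow> (\<Sum>F\<in>Pow M. (- 1) ^ card F) = (if M = {} then 1 else 0 :: 'a :: comm_ring_1)"
  using alternating_sum_choose_card[of M 0] by (simp split: if_splits)

section \<open>Power series\<close>

lemma mfps_coeff_zero [simp]: "mfps_coeff 0 m = 0"
  by (simp add: zero_mfps_def)

lemma mfps_coeff_add [simp]: "mfps_coeff (f + g) m = mfps_coeff f m + mfps_coeff g m"
  by (simp add: plus_mfps_def)

lemma mfps_coeff_minus [simp]: "mfps_coeff (f - g) m = mfps_coeff f m - mfps_coeff g m"
  by (simp add: minus_mfps_def)

lemma mfps_coeff_sum: "mfps_coeff (\<Sum>a\<in>A. f a) m = (\<Sum>a\<in>A. mfps_coeff (f a) m)"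
  by (induction A rule: infinite_finite_induct) auto

lemma mfps_coeff_const_mult [simp]: "mfps_coeff (mfps_const c * f) m = c * mfps_coeff f m"
proof -
  have "mfps_coeff (mfps_const c * f) m =
      (\<Sum>a | a \<subseteq># m. if a = {#} then c * mfps_coeff f m else 0)"
    unfolding times_mfps_def mfps_const_def by (auto intro!: sum.cong)
  then show ?thesis by (simp add: sum.delta finite_submultisets)
qed

lemma mfps_coeff_monom_sum: "mfps_coeff (mfps_monom_sum A f) m = of_nat (card {a \<in> A. f a = m})"
  by (simp add: mfps_monom_sum_def)

text \<open>Sorting the pairs by the monomial \<open>u\<close> of their first entry gives the Cauchy
  product. Finiteness of the fibres matters because \<open>card\<close> is 0 on infinite
  sets.\<close>

lemma mfps_monom_sum_times:
  assumes "\<And>m. finite {a \<in> A. f a = m}" and "\<And>m. finite {b \<in> B. g b = m}"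
  shows "mfps_monom_sum A f * mfps_monom_sum B g =
    mfps_monom_sum (A \<times> B) (\<lambda>(a, b). f a + g b)"
proof (rule mfps_eqI)
  fix m
  have "{p \<in> A \<times> B. (\<lambda>(a, b). f a + g b) p = m} =
      (\<Union>u\<in>{u. u \<subseteq># m}. {a \<in> A. f a = u} \<times> {b \<in> B. g b = m - u})"
    by auto
  also have "card \<dots> = (\<Sum>u | u \<subseteq># m. card ({a \<in> A. f a = u} \<times> {b \<in> B. g b = m - u}))"
    using assms by (intro card_UN_disjoint) (auto simp: finite_submultisets)
  finally show "mfps_coeff (mfps_monom_sum A f * mfps_monom_sum B g) m =
      mfps_coeff (mfps_monom_sum (A \<times> B) (\<lambda>(a, b). f a + g b)) m"
    by (simp add: mfps_coeff_monom_sum times_mfps_def card_cartesian_product)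
qed

lemma mfps_monom_sum_reindex:
  assumes "bij_betw h A B" and "\<And>a. a \<in> A \<Longrightarrow> g (h a) = f a"
  shows "mfps_monom_sum A f = mfps_monom_sum B g"
proof (rule mfps_eqI)
  fix m
  have "bij_betw h {a \<in> A. f a = m} {b \<in> B. g b = m}"
    using assms by (auto simp: bij_betw_def inj_on_def)
  then show "mfps_coeff (mfps_monom_sum A f) m = mfps_coeff (mfps_monom_sum B g) m"
    by (simp add: mfps_coeff_monom_sum bij_betw_same_card)
qed

section \<open>Linear independence of the power sums\<close>

text \<open>For positive \<open>ks\<close> of the same length as \<open>lam\<close>, this is the
  term of \<open>power_sum_part lam\<close> that picks the variable with index \<open>ks ! s\<close>
  from the factor of degree \<open>lam ! s\<close>.\<close>

definition monomial :: "nat list \<Rightarrow> nat list \<Rightarrow> nat multiset" where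
  "monomial lam ks = sum_list (map2 replicate_mset lam ks)"

lemma power_sum_part_Cons: "power_sum_part (k # lam) = power_sum k * power_sum_part lam"
  by (simp add: power_sum_part_def)

lemma power_sum_part_coeff_nonneg: "mfps_coeff (power_sum_part lam) m \<ge> 0"
proof (induction lam arbitrary: m)
  case Nil
  then show ?case by (simp add: power_sum_part_def one_mfps_def)
next
  case (Cons k lam)
  have "mfps_coeff (power_sum k) u \<ge> 0" for u
    by (simp add: power_sum_def mfps_coeff_monom_sum)
  with Cons show ?case
    by (auto simp: power_sum_part_Cons times_mfps_def intro!: sum_nonneg)
qed

lemma power_sum_coeff_replicate_pos:
  assumes "k > 0" "i > 0"
  shows "mfps_coeff (power_sum k) (replicate_mset k i) > 0"
proof -
  have "{j \<in> {1..}. replicate_mset k j = replicate_mset k i} = {i}"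
    using assms by (auto simp: replicate_mset_eq_iff)
  then show ?thesis by (simp add: power_sum_def mfps_coeff_monom_sum)
qed

text \<open>All coefficients of products of power sums are nonnegative, so nothing can cancel the
  positive summand singled out by \<open>ks\<close>.\<close>

lemma power_sum_part_coeff_monomial_pos:
  assumes "length lam = length ks" "\<forall>k\<in>set lam. k > 0" "\<forall>i\<in>set ks. i > 0"
  shows "mfps_coeff (power_sum_part lam) (monomial lam ks) > 0"
  using assms
proof (induction lam ks rule: list_induct2)
  case Nil
  then show ?case by (simp add: power_sum_part_def one_mfps_def monomial_def)
next
  case (Cons k lam i ks)
  let ?f = "mfps_coeff (power_sum k)" and ?g = "mfps_coeff (power_sum_part lam)"
  let ?m = "monomial (k # lam) (i # ks)"
  have m: "?m = replicate_mset k i + monomial lam ks"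
    by (simp add: monomial_def)
  have "0 < ?f (replicate_mset k i) * ?g (?m - replicate_mset k i)"
    using Cons by (auto simp: m intro!: mult_pos_pos power_sum_coeff_replicate_pos)
  also have "\<dots> \<le> (\<Sum>a | a \<subseteq># ?m. ?f a * ?g (?m - a))"
    by (rule member_le_sum)
      (auto simp: m finite_submultisets power_sum_part_coeff_nonneg power_sum_def
        mfps_coeff_monom_sum)
  finally show ?case
    by (simp add: power_sum_part_Cons times_mfps_def)
qed

lemma power_sum_part_coeff_nonzeroE:
  assumes "mfps_coeff (power_sum_part lam) m \<noteq> 0"
  obtains ks where "length ks = length lam" "m = monomial lam ks"
proof -
  have "\<exists>ks. length ks = length lam \<and> m = monomial lam ks"
    using assms
  proof (induction lam arbitrary: m)
    case Nil
    then show ?case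
      by (auto simp: power_sum_part_def one_mfps_def monomial_def split: if_splits)
  next
    case (Cons k lam)
    then obtain a where a: "a \<subseteq># m" "mfps_coeff (power_sum k) a \<noteq> 0"
      "mfps_coeff (power_sum_part lam) (m - a) \<noteq> 0"
      unfolding power_sum_part_Cons times_mfps_def
      by (auto elim!: sum.not_neutral_contains_not_neutral)
    obtain ks where ks: "length ks = length lam" "m - a = monomial lam ks"
      using Cons.IH[OF a(3)] by blast
    obtain i where i: "a = replicate_mset k i"
    proof -
      have "{i \<in> {1..}. replicate_mset k i = a} \<noteq> {}"
        using a(2) unfolding power_sum_def mfps_coeff_monom_sum by (metis card.empty of_nat_0)
      with that show ?thesis by blast
    qed
    have "m = a + monomial lam ks"
      using a(1) ks(2) by (metis subset_mset.add_diff_inverse)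
    then show ?case
      using ks(1) i by (intro exI[of _ "i # ks"]) (simp add: monomial_def)
  qed
  with that show ?thesis by blast
qed

lemma set_mset_monomial:
  "length lam = length ks \<Longrightarrow> \<forall>k\<in>set lam. k > 0 \<Longrightarrow> set_mset (monomial lam ks) = set ks"
  by (induction lam ks rule: list_induct2) (auto simp: monomial_def)

text \<open>With distinct variables no two parts merge, so every exponent is a single part of
  \<open>lam\<close>.\<close>

lemma counts_monomial:
  "length lam = length ks \<Longrightarrow> \<forall>k\<in>set lam. k > 0 \<Longrightarrow> distinct ks \<Longrightarrow>
    map (count (monomial lam ks)) ks = lam"
proof (induction lam ks rule: list_induct2)
  case (Cons k lam i ks)
  let ?m = "monomial (k # lam) (i # ks)"
  have m: "?m = replicate_mset k i + monomial lam ks"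
    by (simp add: monomial_def)
  have "i \<notin># monomial lam ks"
    using Cons by (simp add: set_mset_monomial)
  moreover have "map (count ?m) ks = map (count (monomial lam ks)) ks"
    using Cons.prems by (auto simp: m)
  ultimately show ?case
    using Cons.IH Cons.prems by (simp only: list.map m) (simp add: not_in_iff)
qed simp

lemma partition_eqI:
  assumes "lam \<in> partitions n" "mu \<in> partitions n" "mset lam = mset mu"
  shows "lam = mu"
proof -
  have "sorted (rev lam)" "sorted (rev mu)"
    using assms by (auto simp: partitions_def sorted_wrt_rev)
  with assms(3) have "rev lam = rev mu"
    by (metis mset_rev properties_for_sort)
  then show ?thesis by simp
qed

text \<open>
  Every monomial of \<open>p\<^sub>\<lambda>\<close> merges parts of \<open>\<lambda>\<close>, so it has at most \<open>l(\<lambda>)\<close> variables, with equality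
  only if no parts are merged.
\<close>

lemma power_sum_part_coeff_triangular:
  assumes lam: "lam \<in> partitions n" and mu: "mu \<in> partitions n"
    and len: "length lam \<le> length mu"
    and nz: "mfps_coeff (power_sum_part lam) (monomial mu [1..<Suc (length mu)]) \<noteq> 0"
  shows "lam = mu"
proof -
  let ?js = "[1..<Suc (length mu)]"
  obtain ks where ks: "length ks = length lam" "monomial mu ?js = monomial lam ks"
    using nz by (rule power_sum_part_coeff_nonzeroE)
  have pos: "\<forall>k\<in>set lam. k > 0" "\<forall>k\<in>set mu. k > 0"
    using lam mu by (auto simp: partitions_def)
  have sets: "set ks = set ?js"
    using ks pos by (metis diff_Suc_1 length_upt set_mset_monomial)
  then have "card (set ks) = length mu"
    by (simp only: set_upt card_atLeastLessThan diff_Suc_1)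
  then have "length ks = length mu" "distinct ks"
    using len ks(1) card_length[of ks] by (auto intro: card_distinct)
  then have "mset ks = mset ?js"
    using sets by (metis distinct_upt set_eq_iff_mset_eq_distinct)
  moreover have "map (count (monomial mu ?js)) ?js = mu"
    by (rule counts_monomial) (use pos in \<open>simp_all del: upt_Suc\<close>)
  moreover have "map (count (monomial lam ks)) ks = lam"
    by (rule counts_monomial) (use pos ks \<open>distinct ks\<close> in auto)
  ultimately have "mset lam = mset mu"
    using ks(2) by (metis mset_map)
  with lam mu show ?thesis by (rule partition_eqI)
qed

text \<open>Triangularity: among the partitions with nonzero coefficient take a longest one,
  \<open>mu\<close>. A monomial with exponents \<open>mu\<close> on distinct variables occurs in no
  other \<open>power_sum_part nu\<close> of the relation, so its coefficient isolates
  \<open>c mu\<close>.\<close>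

lemma power_sum_part_independent:
  assumes zero: "(\<Sum>lam\<in>partitions n. mfps_const (c lam) * power_sum_part lam) = 0"
    and "lam \<in> partitions n"
  shows "c lam = 0"
proof (rule ccontr)
  define N where "N = {mu \<in> partitions n. c mu \<noteq> 0}"
  assume "c lam \<noteq> 0"
  with assms(2) have "N \<noteq> {}" by (auto simp: N_def)
  moreover have "finite N" by (simp add: N_def finite_partitions)
  ultimately have "Max (length ` N) \<in> length ` N" "\<forall>nu\<in>N. length nu \<le> Max (length ` N)"
    by simp_all
  then obtain mu where mu: "mu \<in> N" "\<And>nu. nu \<in> N \<Longrightarrow> length nu \<le> length mu"
    by auto
  \<comment> \<open>The indices start at 1 since variable 0 does not occur in
    \<open>power_sum\<close>; this keeps the coefficient of \<open>power_sum_part mu\<close> at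
    \<open>m\<close> positive.\<close>
  define m where "m = monomial mu [1..<Suc (length mu)]"
  have "0 = (\<Sum>lam\<in>partitions n. c lam * mfps_coeff (power_sum_part lam) m)"
    using arg_cong[OF zero, of "\<lambda>f. mfps_coeff f m"] by (simp add: mfps_coeff_sum)
  also have "\<dots> = (\<Sum>lam\<in>partitions n. if lam = mu then c mu * mfps_coeff (power_sum_part mu) m else 0)"
    using mu power_sum_part_coeff_triangular[of _ n mu]
    by (intro sum.cong) (fastforce simp: N_def m_def simp del: upt_Suc)+
  also have "\<dots> = c mu * mfps_coeff (power_sum_part mu) m"
    using mu(1) by (simp add: N_def finite_partitions)
  also have "\<dots> \<noteq> 0"
    using mu(1) power_sum_part_coeff_monomial_pos[of mu "[1..<Suc (length mu)]"]
    by (auto simp: N_def m_def partitions_def simp del: upt_Suc)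
  finally show False by simp
qed

text \<open>\<open>power_sum_coeffs\<close> is a definite description: \<open>c\<close> itself
  witnesses existence, and linear independence applied to the difference of two coefficient families
  gives uniqueness.\<close>

lemma power_sum_coeffs_eqI:
  assumes "\<And>lam. lam \<notin> partitions n \<Longrightarrow> c lam = 0"
    and "f = (\<Sum>lam\<in>partitions n. mfps_const (c lam) * power_sum_part lam)"
  shows "power_sum_coeffs n f = c"
  unfolding power_sum_coeffs_def
proof (rule the_equality)
  fix d
  assume d: "(\<forall>lam. lam \<notin> partitions n \<longrightarrow> d lam = 0) \<and>
    f = (\<Sum>lam\<in>partitions n. mfps_const (d lam) * power_sum_part lam)"
  have "(\<Sum>lam\<in>partitions n. mfps_const (d lam - c lam) * power_sum_part lam) = f - f"
    by (subst (1) assms(2), subst d[THEN conjunct2])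
      (auto intro!: mfps_eqI simp: mfps_coeff_sum sum_subtractf[symmetric] left_diff_distrib)
  then have "d lam - c lam = 0" if "lam \<in> partitions n" for lam
    using power_sum_part_independent[of "\<lambda>lam. d lam - c lam" n] that by simp
  then show "d = c"
    using d assms(1) by (intro ext) (metis eq_iff_diff_eq_0)
qed (use assms in auto)


section \<open>Components of forests\<close>

text \<open>Reflexive on the whole type, so a vertex that lies on no edge of \<open>S\<close> still
  forms a class of its own.\<close>

definition reach :: "'v set set \<Rightarrow> ('v \<times> 'v) set" where
  "reach S = {(a, b). {a, b} \<in> S}\<^sup>*"

definition components :: "'v graph \<Rightarrow> 'v set set" where
  "components G = (\<lambda>v. reach (edges G) `` {v}) ` verts G"

text \<open>Acyclicity in the form that every edge is a bridge. It passes to subsets and fits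
  arguments that add one edge at a time; \<open>finite_tree_forest\<close> derives it from the
  absence of a \<open>graph_cycle\<close>.\<close>

definition forest :: "'v set set \<Rightarrow> bool" where
  "forest S \<longleftrightarrow> (\<forall>a b. {a, b} \<in> S \<longrightarrow> (a, b) \<notin> reach (S - {{a, b}}))"

lemma connected_graph_iff_reach:
  "connected_graph G \<longleftrightarrow>
    verts G \<noteq> {} \<and> (\<forall>u\<in>verts G. \<forall>v\<in>verts G. (u, v) \<in> reach (edges G))"
  by (simp add: connected_graph_def reach_def)

lemma reach_refl [simp]: "(a, a) \<in> reach S"
  by (simp add: reach_def)

lemma reach_trans: "(a, b) \<in> reach S \<Longrightarrow> (b, c) \<in> reach S \<Longrightarrow> (a, c) \<in> reach S"
  by (simp add: reach_def)

lemma reach_step: "(a, b) \<in> reach S \<Longrightarrow> {b, c} \<in> S \<Longrightarrow> (a, c) \<in> reach S"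
  by (auto simp: reach_def intro: rtrancl_into_rtrancl)

lemma reach_induct [consumes 1, case_names refl step]:
  assumes "(a, b) \<in> reach S" "P a"
    and "\<And>b c. (a, b) \<in> reach S \<Longrightarrow> {b, c} \<in> S \<Longrightarrow> P b \<Longrightarrow> P c"
  shows "P b"
  using assms(1) unfolding reach_def
  by induction (use assms(2,3) in \<open>auto simp: reach_def\<close>)

lemma reach_sym: "(a, b) \<in> reach S \<Longrightarrow> (b, a) \<in> reach S"
  unfolding reach_def by (rule symD[OF sym_rtrancl]) (auto simp: sym_def insert_commute)

lemma reach_mono: "S \<subseteq> S' \<Longrightarrow> reach S \<subseteq> reach S'"
  unfolding reach_def by (rule rtrancl_mono) auto

lemma reach_Image_eq: "(a, b) \<in> reach S \<Longrightarrow> reach S `` {a} = reach S `` {b}"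
  by (auto intro: reach_trans reach_sym)

lemma reach_invariant:
  assumes "(a, b) \<in> reach S" and "\<And>u v. {u, v} \<in> S \<Longrightarrow> f u = f v"
  shows "f a = f b"
  using assms(1) by (induction rule: reach_induct) (auto dest: assms(2))

text \<open>No edge of \<open>S\<close> leaves \<open>V\<close>, so a walk that starts in
  \<open>V\<close> stays there and uses only edges inside \<open>V\<close>.\<close>

lemma reach_closed:
  assumes "(a, b) \<in> reach S" "a \<in> V" and "\<And>e. e \<in> S \<Longrightarrow> e \<inter> V \<noteq> {} \<Longrightarrow> e \<subseteq> V"
  shows "b \<in> V" "(a, b) \<in> reach {e \<in> S. e \<subseteq> V}"
proof -
  have "b \<in> V \<and> (a, b) \<in> reach {e \<in> S. e \<subseteq> V}"
    using assms(1)
  proof (induction rule: reach_induct)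
    case (step b c)
    then have "{b, c} \<subseteq> V"
      using assms(3)[of "{b, c}"] by auto
    with step show ?case
      by (auto intro: reach_step)
  qed (use assms(2) in auto)
  then show "b \<in> V" "(a, b) \<in> reach {e \<in> S. e \<subseteq> V}" by auto
qed

text \<open>A walk needs the new edge at most once, in one of its two directions; each direction is
  one pair inserted into the underlying relation.\<close>

lemma reach_insert:
  "(x, y) \<in> reach (insert {a, b} S) \<longleftrightarrow> (x, y) \<in> reach S
     \<or> (x, a) \<in> reach S \<and> (b, y) \<in> reach S \<or> (x, b) \<in> reach S \<and> (a, y) \<in> reach S"
proof -
  have "{(u, v). {u, v} \<in> insert {a, b} S} = insert (a, b) (insert (b, a) {(u, v). {u, v} \<in> S})"
    by (auto simp: doubleton_eq_iff)
  then have "(x, y) \<in> reach (insert {a, b} S) \<longleftrightarrow>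
      (x, y) \<in> (insert (a, b) (insert (b, a) {(u, v). {u, v} \<in> S}))\<^sup>*"
    by (simp only: reach_def)
  also have "\<dots> \<longleftrightarrow> (x, y) \<in> reach S
     \<or> (x, a) \<in> reach S \<and> (b, y) \<in> reach S \<or> (x, b) \<in> reach S \<and> (a, y) \<in> reach S"
    unfolding rtrancl_insert by (fold reach_def) (auto intro: reach_trans)
  finally show ?thesis .
qed

lemma finite_graph_finite_edges: "finite_graph G \<Longrightarrow> finite (edges G)"
  by (rule finite_subset[of _ "Pow (verts G)"]) (auto simp: finite_graph_def)

lemma finite_components: "finite_graph G \<Longrightarrow> finite (components G)"
  by (simp add: components_def finite_graph_def)

lemma component_nonempty:
  assumes "C \<in> components G"
  shows "C \<noteq> {}"
proof -
  obtain v where "C = reach (edges G) `` {v}"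
    using assms by (auto simp: components_def)
  then have "v \<in> C" by simp
  then show ?thesis by auto
qed

lemma components_disjoint:
  assumes "C \<in> components G" "D \<in> components G" "C \<inter> D \<noteq> {}"
  shows "C = D"
  using assms by (auto simp: components_def dest: reach_Image_eq)

lemma Union_components:
  assumes "finite_graph G"
  shows "\<Union> (components G) = verts G"
proof
  have "w \<in> verts G" if "(v, w) \<in> reach (edges G)" "v \<in> verts G" for v w
    using that(1,2) by (rule reach_closed(1)) (use assms in \<open>auto simp: finite_graph_def\<close>)
  then show "\<Union> (components G) \<subseteq> verts G"
    by (auto simp: components_def)
qed (auto simp: components_def)

text \<open>The new edge merges the distinct classes \<open>A\<close> and \<open>B\<close> of its
  ends and leaves every other class as it was.\<close>

lemma card_components_insert:
  assumes fin: "finite_graph (V, S)" and ab: "a \<in> V" "b \<in> V" "(a, b) \<notin> reach S"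
  shows "Suc (card (components (V, insert {a, b} S))) = card (components (V, S))"
proof -
  define K where "K = components (V, S)"
  define A where "A = reach S `` {a}"
  define B where "B = reach S `` {b}"
  have A: "A \<in> K" and B: "B \<in> K"
    using ab by (auto simp: K_def A_def B_def components_def)
  have "A \<noteq> B"
    using ab(3) by (auto simp: A_def B_def)
  have AB: "reach (insert {a, b} S) `` {v} = A \<union> B" if "v \<in> A \<union> B" for v
    using that unfolding A_def B_def
    by (auto simp: reach_insert intro: reach_trans reach_sym)
      (meson reach_trans reach_sym)+
  have other: "reach (insert {a, b} S) `` {v} = reach S `` {v}" if "v \<notin> A \<union> B" for v
    using that unfolding A_def B_def by (auto simp: reach_insert dest: reach_sym)
  have "components (V, insert {a, b} S) = insert (A \<union> B) (K - {A, B})"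
  proof (rule set_eqI)
    fix X
    have "X \<in> components (V, insert {a, b} S) \<longleftrightarrow>
        (\<exists>v\<in>V. v \<in> A \<union> B \<and> X = A \<union> B \<or> v \<notin> A \<union> B \<and> X = reach S `` {v})"
      unfolding components_def using AB other by (fastforce simp: image_iff)
    also have "\<dots> \<longleftrightarrow> X = A \<union> B \<or> (\<exists>v\<in>V. v \<notin> A \<union> B \<and> X = reach S `` {v})"
      using ab by (auto simp: A_def)
    also have "(\<exists>v\<in>V. v \<notin> A \<union> B \<and> X = reach S `` {v}) \<longleftrightarrow> X \<in> K - {A, B}"
    proof -
      have "v \<in> A \<longleftrightarrow> reach S `` {v} = A" "v \<in> B \<longleftrightarrow> reach S `` {v} = B" for v
        unfolding A_def B_def using reach_Image_eq by fastforce+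
      then show ?thesis by (auto simp: K_def components_def)
    qed
    finally show "X \<in> components (V, insert {a, b} S) \<longleftrightarrow> X \<in> insert (A \<union> B) (K - {A, B})"
      by simp
  qed
  \<comment> \<open>Hence the merged class is counted as new: two classes disappear and exactly one
    is added.\<close>
  moreover have "A \<union> B \<notin> K"
    using A B \<open>A \<noteq> B\<close> components_disjoint component_nonempty unfolding K_def
    by (metis Int_absorb2 Un_upper1 Un_upper2)
  moreover have "finite K"
    using finite_components[OF fin] by (simp add: K_def)
  ultimately have "card (components (V, insert {a, b} S)) = Suc (card (K - {A, B}))"
    by simp
  also have "card (K - {A, B}) = card K - 2"
    using A B \<open>A \<noteq> B\<close> by (subst card_Diff_subset) auto
  finally show ?thesis
    using A B \<open>A \<noteq> B\<close> \<open>finite K\<close> card_mono[of K "{A, B}"] by (auto simp: K_def)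
qed

section \<open>Counting components of forests; trees as connected forests\<close>

lemma forest_subset: "forest S \<Longrightarrow> S' \<subseteq> S \<Longrightarrow> forest S'"
  unfolding forest_def using reach_mono[of "S' - {e}" "S - {e}" for e]
  by (meson Diff_mono order_refl subset_iff)

text \<open>Without edges there are \<open>card V\<close> components, and each added edge, being a
  bridge, lowers their number by one.\<close>

lemma card_components_forest:
  assumes "finite_graph (V, S)" "forest S"
  shows "card (components (V, S)) + card S = card V"
proof -
  have "finite S"
    using finite_graph_finite_edges[OF assms(1)] by simp
  then show ?thesis using assms
  proof (induction S)
    case empty
    have "components (V, {}) = (\<lambda>v. {v}) ` V"
      by (auto simp: components_def reach_def)
    then show ?case by (simp add: card_image)
  next
    case (insert e S)
    then have fin: "finite_graph (V, S)" and e: "e \<subseteq> V" "card e = 2"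
      by (auto simp: finite_graph_def)
    then obtain a b where ab: "e = {a, b}" "a \<in> V" "b \<in> V"
      by (auto simp: card_2_iff)
    have "(a, b) \<notin> reach S"
      using insert.prems(2) insert.hyps(2) ab(1) by (metis Diff_insert_absorb forest_def insertI1)
    then have "Suc (card (components (V, insert e S))) = card (components (V, S))"
      unfolding ab(1) using fin ab(2,3) by (intro card_components_insert)
    moreover have "card (components (V, S)) + card S = card V"
      using fin forest_subset[OF insert.prems(2)] by (intro insert.IH) auto
    ultimately show ?case
      using insert.hyps by simp
  qed
qed

text \<open>A step to a new vertex is appended to the path; a step to a vertex already on the path
  cuts the path off at that vertex.\<close>

lemma rtrancl_distinct_path:
  assumes "(a, b) \<in> r\<^sup>*"
  obtains xs where "xs \<noteq> []" "distinct xs" "hd xs = a" "last xs = b"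
    "\<And>i. Suc i < length xs \<Longrightarrow> (xs ! i, xs ! Suc i) \<in> r"
proof -
  have "\<exists>xs. xs \<noteq> [] \<and> distinct xs \<and> hd xs = a \<and> last xs = b \<and>
      (\<forall>i. Suc i < length xs \<longrightarrow> (xs ! i, xs ! Suc i) \<in> r)"
    using assms
  proof induction
    case base
    show ?case by (rule exI[of _ "[a]"]) simp
  next
    case (step b c)
    then obtain xs where xs: "xs \<noteq> []" "distinct xs" "hd xs = a" "last xs = b"
      "\<forall>i. Suc i < length xs \<longrightarrow> (xs ! i, xs ! Suc i) \<in> r" by blast
    show ?case
    proof (cases "c \<in> set xs")
      case True
      then obtain k where k: "k < length xs" "xs ! k = c"
        by (auto simp: in_set_conv_nth)
      then have "last (take (Suc k) xs) = c"
        by (simp add: take_Suc_conv_app_nth)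
      with xs k show ?thesis
        by (intro exI[of _ "take (Suc k) xs"]) (auto simp: hd_take)
    next
      case False
      with xs step.hyps(2) show ?thesis
        by (intro exI[of _ "xs @ [c]"])
          (auto simp: nth_append last_conv_nth less_Suc_eq Suc_diff_1 not_less_eq
            split: if_splits dest: sym[of "Suc _"])
    qed
  qed
  with that show ?thesis by blast
qed

text \<open>If an edge were not a bridge, a simple path joining its ends without using it would
  close up with it to a cycle.\<close>

lemma finite_tree_forest:
  assumes "finite_tree T"
  shows "forest (edges T)"
  unfolding forest_def
proof (intro allI impI notI)
  fix a b
  assume ab: "{a, b} \<in> edges T" and path: "(a, b) \<in> reach (edges T - {{a, b}})"
  obtain xs where xs: "xs \<noteq> []" "distinct xs" "hd xs = a" "last xs = b"
    and step: "\<And>i. Suc i < length xs \<Longrightarrow> {xs ! i, xs ! Suc i} \<in> edges T - {{a, b}}"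
    using path unfolding reach_def by (rule rtrancl_distinct_path) auto
  have ends: "xs ! 0 = a" "xs ! (length xs - 1) = b"
    using xs by (auto simp: hd_conv_nth last_conv_nth)
  \<comment> \<open>Distinct ends exclude a path with one vertex, and avoiding the edge itself
    excludes one with two, so the cycle has the required length 3 or more.\<close>
  have "a \<noteq> b"
    using ab assms by (force simp: finite_tree_def finite_graph_def)
  then have "length xs \<noteq> 1" "length xs \<noteq> 2" "length xs \<noteq> 0"
    using ends step[of 0] xs(1) by auto
  then have "length xs \<ge> 3" by linarith
  moreover have "{xs ! i, xs ! (Suc i mod length xs)} \<in> edges T" if "i < length xs" for i
  proof (cases "Suc i < length xs")
    case True
    then show ?thesis using step by auto
  next
    case False
    with that have "i = length xs - 1" "Suc i = length xs" by auto
    then have "xs ! i = b" "xs ! (Suc i mod length xs) = a" using ends by auto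
    with ab show ?thesis by (simp add: insert_commute)
  qed
  ultimately have "graph_cycle T xs"
    using xs(2) by (simp add: graph_cycle_def)
  with assms show False by (auto simp: finite_tree_def)
qed

lemma components_connected:
  assumes "finite_graph G" "connected_graph G"
  shows "components G = {verts G}"
proof -
  have "reach (edges G) `` {v} = verts G" if "v \<in> verts G" for v
  proof
    show "verts G \<subseteq> reach (edges G) `` {v}"
      using assms(2) that by (auto simp: connected_graph_iff_reach)
    show "reach (edges G) `` {v} \<subseteq> verts G"
      using Union_components[OF assms(1)] that by (auto simp: components_def)
  qed
  then show ?thesis
    using assms(2) by (auto simp: components_def connected_graph_iff_reach image_iff)
qed

lemma card_edges_connected_forest:
  assumes "finite_graph G" "connected_graph G" "forest (edges G)"
  shows "Suc (card (edges G)) = card (verts G)"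
  using card_components_forest[of "verts G" "edges G"] components_connected[OF assms(1,2)] assms
  by simp

section \<open>Subtrees as components of edge subsets\<close>

text \<open>The ends of an edge inside \<open>verts H\<close> are joined by a path in
  \<open>H\<close>. If the edge were not in \<open>H\<close>, this path would bypass it, although it
  is a bridge of \<open>T\<close>. So a subtree is determined by its vertex set.\<close>

lemma subtree_induced:
  assumes "H \<in> subtrees T" "finite_graph T" "forest (edges T)"
  shows "edges H = {e \<in> edges T. e \<subseteq> verts H}"
proof
  show "edges H \<subseteq> {e \<in> edges T. e \<subseteq> verts H}"
    using assms(1) by (auto simp: subtrees_def subgraph_def finite_graph_def)
  show "{e \<in> edges T. e \<subseteq> verts H} \<subseteq> edges H"
  proof
    fix e assume e: "e \<in> {e \<in> edges T. e \<subseteq> verts H}"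
    with assms(2) have "card e = 2" by (auto simp: finite_graph_def)
    then obtain a b where ab: "e = {a, b}" by (auto simp: card_2_iff)
    then have path: "(a, b) \<in> reach (edges H)"
      using e assms(1) by (auto simp: subtrees_def connected_graph_iff_reach)
    show "e \<in> edges H"
    proof (rule ccontr)
      assume "e \<notin> edges H"
      then have "edges H \<subseteq> edges T - {{a, b}}"
        using assms(1) ab by (auto simp: subtrees_def subgraph_def)
      with path have "(a, b) \<in> reach (edges T - {{a, b}})"
        using reach_mono by blast
      then show False
        using assms(3) e ab by (auto simp: forest_def)
    qed
  qed
qed

lemma inj_on_verts_subtrees:
  assumes "finite_graph T" "forest (edges T)"
  shows "inj_on verts (subtrees T)"
  by (rule inj_onI) (metis assms prod_eqI subtree_induced)

lemma finite_subtrees: "finite_graph T \<Longrightarrow> finite (subtrees T)"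
  by (rule finite_subset[of _ "Pow (verts T) \<times> Pow (edges T)"])
    (use finite_graph_finite_edges[of T] in
      \<open>auto simp: subtrees_def subgraph_def finite_graph_def\<close>)

lemma card_edge_Int_1_iff:
  assumes "card e = 2"
  shows "card (e \<inter> W) = 1 \<longleftrightarrow> e \<inter> W \<noteq> {} \<and> \<not> e \<subseteq> W"
proof -
  obtain a b where "e = {a, b}" "a \<noteq> b"
    using assms by (auto simp: card_2_iff)
  then show ?thesis by (cases "a \<in> W"; cases "b \<in> W") auto
qed

lemma component_subtree:
  assumes T: "finite_graph T" and S: "S \<subseteq> edges T" and C: "C \<in> components (verts T, S)"
  shows "(C, {e \<in> S. e \<subseteq> C}) \<in> subtrees T"
    and "\<And>e. e \<in> S \<Longrightarrow> e \<inter> C \<noteq> {} \<Longrightarrow> e \<subseteq> C"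
proof -
  have fin: "finite_graph (verts T, S)"
    using T S by (auto simp: finite_graph_def)
  have "C \<subseteq> verts T"
    using Union_components[OF fin] C by auto
  obtain v where v: "C = reach S `` {v}"
    using C by (auto simp: components_def)
  show closed: "e \<subseteq> C" if "e \<in> S" "e \<inter> C \<noteq> {}" for e
  proof -
    have "card e = 2" using that T S by (auto simp: finite_graph_def)
    then obtain a b where "e = {a, b}" by (auto simp: card_2_iff)
    with that show ?thesis unfolding v
      by (auto intro: reach_step simp: insert_commute)
  qed
  have "(a, b) \<in> reach {e \<in> S. e \<subseteq> C}" if "a \<in> C" "b \<in> C" for a b
  proof (rule reach_closed(2)[OF _ that(1) closed])
    show "(a, b) \<in> reach S"
      using that unfolding v by (auto intro: reach_trans reach_sym)
  qed auto
  then have "connected_graph (C, {e \<in> S. e \<subseteq> C})"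
    using component_nonempty[OF C] by (auto simp: connected_graph_iff_reach)
  moreover have "finite C"
    using \<open>C \<subseteq> verts T\<close> T finite_subset by (auto simp: finite_graph_def)
  ultimately show "(C, {e \<in> S. e \<subseteq> C}) \<in> subtrees T"
    using \<open>C \<subseteq> verts T\<close> T S by (auto simp: subtrees_def subgraph_def finite_graph_def)
qed

text \<open>Each component \<open>C\<close> carries the subtree formed by the edges of
  \<open>S\<close> inside \<open>C\<close>. This lets sums over components be reindexed by subtrees
  of \<open>T\<close>.\<close>

lemma components_conv_subtrees:
  assumes "finite_graph T" "S \<subseteq> edges T"
  shows "components (verts T, S) = verts ` {H \<in> subtrees T. verts H \<in> components (verts T, S)}"
proof
  show "components (verts T, S) \<subseteq> verts ` {H \<in> subtrees T. verts H \<in> components (verts T, S)}"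
  proof
    fix C assume C: "C \<in> components (verts T, S)"
    have "verts (C, {e \<in> S. e \<subseteq> C}) = C" by simp
    with C component_subtree(1)[OF assms C]
    show "C \<in> verts ` {H \<in> subtrees T. verts H \<in> components (verts T, S)}"
      by (metis (mono_tags, lifting) image_eqI mem_Collect_eq)
  qed
qed auto

definition boundary :: "'v graph \<Rightarrow> 'v set \<Rightarrow> 'v set set" where
  "boundary G W = {e \<in> edges G. card (e \<inter> W) = 1}"

text \<open>If \<open>edges H\<close> lies in \<open>S\<close>, all of \<open>verts H\<close> is
  connected in \<open>S\<close>, and an edge of \<open>S\<close> leaves \<open>verts H\<close>
  exactly when it is a boundary edge.\<close>

lemma verts_subtree_component_iff:
  assumes T: "finite_graph T" "forest (edges T)" and H: "H \<in> subtrees T" and S: "S \<subseteq> edges T"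
  shows "verts H \<in> components (verts T, S) \<longleftrightarrow> edges H \<subseteq> S \<and> S \<inter> boundary T (verts H) = {}"
proof -
  have two: "card e = 2" if "e \<in> S" for e
    using that S T by (auto simp: finite_graph_def)
  have boundary: "S \<inter> boundary T (verts H) = {} \<longleftrightarrow>
      (\<forall>e\<in>S. e \<inter> verts H \<noteq> {} \<longrightarrow> e \<subseteq> verts H)"
  proof -
    have "S \<inter> boundary T (verts H) = {} \<longleftrightarrow> (\<forall>e\<in>S. card (e \<inter> verts H) \<noteq> 1)"
      using S by (auto simp: boundary_def)
    also have "\<dots> \<longleftrightarrow> (\<forall>e\<in>S. e \<inter> verts H \<noteq> {} \<longrightarrow> e \<subseteq> verts H)"
      by (rule ball_cong[OF refl]) (subst card_edge_Int_1_iff, auto dest: two)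
    finally show ?thesis .
  qed
  show ?thesis
  proof (intro iffI conjI)
    assume C: "verts H \<in> components (verts T, S)"
    note sub = component_subtree[OF T(1) S C]
    \<comment> \<open>Both are subtrees with the same vertex set, hence equal; the edges on the left
      come from \<open>S\<close>.\<close>
    have "(verts H, {e \<in> S. e \<subseteq> verts H}) = H"
      by (rule inj_onD[OF inj_on_verts_subtrees[OF T] _ sub(1) H]) simp
    then show "edges H \<subseteq> S"
      by (metis (mono_tags, lifting) mem_Collect_eq snd_conv subsetI)
    show "S \<inter> boundary T (verts H) = {}"
      using sub(2) by (simp add: boundary)
  next
    assume *: "edges H \<subseteq> S \<and> S \<inter> boundary T (verts H) = {}"
    obtain v where v: "v \<in> verts H"
      using H by (auto simp: subtrees_def connected_graph_iff_reach)
    have "w \<in> verts H" if "(v, w) \<in> reach S" for w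
      by (rule reach_closed(1)[OF that v])
        (use * boundary in auto)
    moreover have "(v, w) \<in> reach S" if "w \<in> verts H" for w
    proof (rule subsetD[OF reach_mono])
      show "(v, w) \<in> reach (edges H)"
        using H v that by (auto simp: subtrees_def connected_graph_iff_reach)
    qed (use * in blast)
    ultimately have "verts H = reach S `` {v}" by auto
    moreover have "v \<in> verts T"
      using H v by (auto simp: subtrees_def subgraph_def)
    ultimately show "verts H \<in> components (verts T, S)"
      by (auto simp: components_def)
  qed
qed


section \<open>Power sum expansion of the chromatic symmetric function\<close>

text \<open>Such a coloring uses only the finitely many colors that occur in
  \<open>m\<close>.\<close>

lemma finite_colorings_of_monomial:
  fixes K :: "'b set"
  assumes "finite V"
  shows "finite {kap \<in> V \<rightarrow>\<^sub>E K. image_mset kap (mset_set V) = m}"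
proof (rule finite_subset)
  show "{kap \<in> V \<rightarrow>\<^sub>E K. image_mset kap (mset_set V) = m} \<subseteq> V \<rightarrow>\<^sub>E set_mset m"
    using assms by (auto intro: PiE_arb)
  show "finite (V \<rightarrow>\<^sub>E set_mset m)"
    using assms by (intro finite_PiE) auto
qed

section \<open>Colorings constant on the blocks of a set partition\<close>

definition block_colorings :: "'v set set \<Rightarrow> ('v \<Rightarrow> nat) set" where
  "block_colorings P = {kap \<in> \<Union>P \<rightarrow>\<^sub>E {1..}. \<forall>C\<in>P. \<forall>u\<in>C. \<forall>v\<in>C. kap u = kap v}"

lemma block_colorings_undefined:
  "kap \<in> block_colorings P \<Longrightarrow> v \<notin> \<Union>P \<Longrightarrow> kap v = undefined"
  unfolding block_colorings_def using PiE_arb by fastforce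

lemma block_colorings_eq:
  "kap \<in> block_colorings P \<Longrightarrow> C \<in> P \<Longrightarrow> u \<in> C \<Longrightarrow> v \<in> C \<Longrightarrow> kap u = kap v"
  unfolding block_colorings_def by blast

text \<open>A coloring constant on blocks amounts to a free choice of a color for \<open>C\<close>
  and a coloring for \<open>P\<close>. The inverse reads the color of \<open>C\<close> off at a
  fixed \<open>c\<close> and restricts to the other blocks.\<close>

lemma bij_betw_block_colorings_insert:
  assumes "C \<noteq> {}" "C \<inter> \<Union>P = {}"
  shows "bij_betw (\<lambda>(i, kap) v. if v \<in> C then i else kap v)
    ({1..} \<times> block_colorings P) (block_colorings (insert C P))"
proof -
  obtain c where c: "c \<in> C" using assms(1) by auto
  have disj: "v \<notin> C" if "v \<in> D" "D \<in> P" for v D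
    using that assms(2) by auto
  let ?h = "\<lambda>i kap v. if v \<in> C then i else kap v :: nat"
  show ?thesis
  proof (rule bij_betw_byWitness[where f' = "\<lambda>kap. (kap c, restrict kap (\<Union>P))"])
    have "restrict (?h i kap) (\<Union>P) = kap" if "kap \<in> block_colorings P" for i kap
      using block_colorings_undefined[OF that] disj by (intro ext) (auto simp: restrict_def)
    with c show "\<forall>p\<in>{1..} \<times> block_colorings P.
        (\<lambda>kap. (kap c, restrict kap (\<Union>P))) ((\<lambda>(i, kap). ?h i kap) p) = p"
      by auto
    show "\<forall>kap\<in>block_colorings (insert C P).
        (\<lambda>(i, kap). ?h i kap) (kap c, restrict kap (\<Union>P)) = kap"
    proof
      fix kap assume kap: "kap \<in> block_colorings (insert C P)"
      have "?h (kap c) (restrict kap (\<Union>P)) v = kap v" for v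
      proof (cases "v \<in> C")
        case True
        then have "kap c = kap v"
          using c by (intro block_colorings_eq[OF kap insertI1])
        with True show ?thesis by simp
      next
        case False
        then show ?thesis
          using block_colorings_undefined[OF kap, of v] by (simp add: restrict_def)
      qed
      then show "(\<lambda>(i, kap). ?h i kap) (kap c, restrict kap (\<Union>P)) = kap"
        by auto
    qed
    have "?h i kap \<in> block_colorings (insert C P)" if "i \<ge> 1" "kap \<in> block_colorings P" for i kap
      unfolding block_colorings_def
    proof (intro CollectI conjI PiE_I ballI)
      fix v assume "v \<in> \<Union>(insert C P)"
      with that show "?h i kap v \<in> {1..}"
        unfolding block_colorings_def by fastforce
    next
      fix v assume "v \<notin> \<Union>(insert C P)"
      then show "?h i kap v = undefined"
        using block_colorings_undefined[OF that(2)] by simp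
    next
      fix D u v assume "D \<in> insert C P" "u \<in> D" "v \<in> D"
      show "?h i kap u = ?h i kap v"
      proof (cases "D = C")
        case True
        with \<open>u \<in> D\<close> \<open>v \<in> D\<close> show ?thesis by simp
      next
        case False
        with \<open>D \<in> insert C P\<close> have "D \<in> P" by simp
        moreover from this have "kap u = kap v"
          using block_colorings_eq[OF that(2), of D] \<open>u \<in> D\<close> \<open>v \<in> D\<close> by blast
        ultimately show ?thesis
          using disj[of u D] disj[of v D] \<open>u \<in> D\<close> \<open>v \<in> D\<close> by simp
      qed
    qed
    then show "(\<lambda>(i, kap). ?h i kap) ` ({1..} \<times> block_colorings P)
        \<subseteq> block_colorings (insert C P)"
      by auto
    show "(\<lambda>kap. (kap c, restrict kap (\<Union>P))) ` block_colorings (insert C P)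
        \<subseteq> {1..} \<times> block_colorings P"
    proof
      fix p assume "p \<in> (\<lambda>kap. (kap c, restrict kap (\<Union>P))) ` block_colorings (insert C P)"
      then obtain kap where p: "p = (kap c, restrict kap (\<Union>P))"
        and kap: "kap \<in> block_colorings (insert C P)" by blast
      have "kap \<in> \<Union>(insert C P) \<rightarrow> {1..}"
        using kap unfolding block_colorings_def by blast
      then have "kap c \<in> {1..}" "restrict kap (\<Union>P) \<in> \<Union>P \<rightarrow>\<^sub>E {1..}"
        using c by auto
      moreover have "\<forall>D\<in>P. \<forall>u\<in>D. \<forall>v\<in>D. restrict kap (\<Union>P) u = restrict kap (\<Union>P) v"
      proof (intro ballI)
        fix D u v assume "D \<in> P" "u \<in> D" "v \<in> D"
        then have "kap u = kap v"
          by (intro block_colorings_eq[OF kap, of D]) auto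
        moreover have "u \<in> \<Union>P" "v \<in> \<Union>P"
          using \<open>D \<in> P\<close> \<open>u \<in> D\<close> \<open>v \<in> D\<close> by auto
        ultimately show "restrict kap (\<Union>P) u = restrict kap (\<Union>P) v" by simp
      qed
      ultimately show "p \<in> {1..} \<times> block_colorings P"
        unfolding p block_colorings_def by blast
    qed
  qed
qed

text \<open>A block \<open>C\<close> of color \<open>i\<close> contributes \<open>card C\<close>
  copies of the variable \<open>i\<close>; summing over \<open>i\<close> gives
  \<open>power_sum (card C)\<close>, and the blocks are colored independently.\<close>

lemma monom_sum_block_colorings:
  assumes "finite P" "\<And>C. C \<in> P \<Longrightarrow> finite C \<and> C \<noteq> {}"
    and "\<And>C D. C \<in> P \<Longrightarrow> D \<in> P \<Longrightarrow> C \<noteq> D \<Longrightarrow> C \<inter> D = {}"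
  shows "mfps_monom_sum (block_colorings P) (\<lambda>kap. image_mset kap (mset_set (\<Union>P))) =
    (\<Prod>C\<in>P. power_sum (card C))"
  using assms
proof (induction P)
  case empty
  \<comment> \<open>The only coloring of no blocks is \<open>undefined\<close> everywhere; its
    monomial is empty, which gives the series 1.\<close>
  then show ?case
    by (auto intro!: mfps_eqI simp: mfps_coeff_monom_sum block_colorings_def one_mfps_def)
next
  case (insert C P)
  have C: "finite C" "C \<noteq> {}" "C \<inter> \<Union>P = {}" and P: "finite (\<Union>P)"
  proof -
    show "finite C" "C \<noteq> {}" "finite (\<Union>P)"
      using insert.prems(1) insert.hyps(1) by auto
    have "C \<inter> D = {}" if "D \<in> P" for D
      using insert.prems(2)[of C D] insert.hyps(2) that by auto
    then show "C \<inter> \<Union>P = {}" by blast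
  qed
  \<comment> \<open>Here \<open>C\<close> must be nonempty: otherwise every color would yield the
    empty monomial.\<close>
  have fin1: "finite {i \<in> {1..}. replicate_mset (card C) i = m}" for m :: "nat multiset"
    by (rule finite_subset[of _ "set_mset m"]) (use C in \<open>auto split: if_splits\<close>)
  have fin2: "finite {kap \<in> block_colorings P. image_mset kap (mset_set (\<Union>P)) = m}" for m
    by (rule finite_subset[OF _ finite_colorings_of_monomial[OF P, of "{1..}" m]])
      (auto simp: block_colorings_def)
  have mon: "image_mset (\<lambda>v. if v \<in> C then i else kap v) (mset_set (\<Union>(insert C P))) =
      replicate_mset (card C) i + image_mset kap (mset_set (\<Union>P))" for i :: nat and kap
  proof -
    have "image_mset (\<lambda>v. if v \<in> C then i else kap v) (mset_set C) = image_mset (\<lambda>_. i) (mset_set C)"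
      "image_mset (\<lambda>v. if v \<in> C then i else kap v) (mset_set (\<Union>P)) = image_mset kap (mset_set (\<Union>P))"
      by (rule image_mset_cong; use C P in auto)+
    then show ?thesis
      using C P by (simp add: mset_set_Union image_mset_const_eq)
  qed
  have "mfps_monom_sum (block_colorings (insert C P))
      (\<lambda>kap. image_mset kap (mset_set (\<Union>(insert C P)))) =
      mfps_monom_sum ({1..} \<times> block_colorings P)
        (\<lambda>(i, kap). replicate_mset (card C) i + image_mset kap (mset_set (\<Union>P)))"
    by (rule mfps_monom_sum_reindex[symmetric, OF bij_betw_block_colorings_insert[OF C(2,3)]])
      (auto simp only: mon split: prod.splits)
  also have "\<dots> = power_sum (card C) *
      mfps_monom_sum (block_colorings P) (\<lambda>kap. image_mset kap (mset_set (\<Union>P)))"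
    unfolding power_sum_def by (rule mfps_monom_sum_times[symmetric, OF fin1 fin2])
  finally show ?case
    using insert by simp
qed

text \<open>The coefficients are compared one monomial \<open>m\<close> at a time, because only
  finitely many colorings (the set \<open>K\<close>) produce \<open>m\<close>, so that the sums over
  colorings and over edge sets may be exchanged.\<close>

lemma chromatic_symmetric_function_expansion:
  assumes G: "finite_graph G"
  shows "chromatic_symmetric_function G = (\<Sum>S\<in>Pow (edges G).
    mfps_const ((- 1) ^ card S) * (\<Prod>C\<in>components (verts G, S). power_sum (card C)))"
proof (rule mfps_eqI)
  fix m :: "nat multiset"
  let ?mon = "\<lambda>kap. image_mset kap (mset_set (verts G))"
  define K where "K = {kap \<in> verts G \<rightarrow>\<^sub>E {1..}. ?mon kap = m}"
  define mono where "mono = (\<lambda>kap :: 'a \<Rightarrow> nat. {e \<in> edges G. \<exists>c. \<forall>v\<in>e. kap v = c})"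
  have mono_iff: "{u, v} \<in> mono kap \<longleftrightarrow> {u, v} \<in> edges G \<and> kap u = kap v" for u v kap
    by (auto simp: mono_def)
  have mono_edges: "mono kap \<subseteq> edges G" for kap
    by (auto simp: mono_def)
  have E: "finite (edges G)" using G by (rule finite_graph_finite_edges)
  have V: "finite (verts G)" using G by (simp add: finite_graph_def)
  have "finite K" unfolding K_def using V by (rule finite_colorings_of_monomial)
  have doubleton: "\<exists>u v. e = {u, v}" if "e \<in> edges G" for e
  proof -
    have "card e = 2" using that G by (simp add: finite_graph_def)
    then show ?thesis by (auto simp: card_2_iff)
  qed
  have proper: "{kap \<in> proper_colorings G. ?mon kap = m} = {kap \<in> K. mono kap = {}}"
  proof -
    have "(\<forall>u v. {u, v} \<in> edges G \<longrightarrow> kap u \<noteq> kap v) \<longleftrightarrow> mono kap = {}" for kap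
    proof
      assume *: "\<forall>u v. {u, v} \<in> edges G \<longrightarrow> kap u \<noteq> kap v"
      have "e \<notin> mono kap" for e
      proof
        assume e: "e \<in> mono kap"
        then obtain u v where "e = {u, v}" using doubleton[of e] mono_edges by blast
        with e have "{u, v} \<in> edges G" "kap u = kap v" by (simp_all add: mono_iff)
        with * show False by blast
      qed
      then show "mono kap = {}" by blast
    next
      assume *: "mono kap = {}"
      have "{u, v} \<in> mono kap" if "{u, v} \<in> edges G" "kap u = kap v" for u v
        using that by (simp add: mono_iff)
      with * show "\<forall>u v. {u, v} \<in> edges G \<longrightarrow> kap u \<noteq> kap v" by blast
    qed
    then show ?thesis by (auto simp: proper_colorings_def K_def)
  qed
  have blocks: "mfps_coeff (\<Prod>C\<in>components (verts G, S). power_sum (card C)) m =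
      of_nat (card {kap \<in> K. S \<subseteq> mono kap})" if S: "S \<subseteq> edges G" for S
  proof -
    let ?P = "components (verts G, S)"
    have fin: "finite_graph (verts G, S)"
      using G S by (auto simp: finite_graph_def)
    have U: "\<Union>?P = verts G"
      using Union_components[OF fin] by simp
    \<comment> \<open>All edges of \<open>S\<close> are monochromatic exactly when the color is
      constant along walks in \<open>S\<close>, that is, on components.\<close>
    have "(\<forall>C\<in>?P. \<forall>u\<in>C. \<forall>v\<in>C. kap u = kap v) \<longleftrightarrow> S \<subseteq> mono kap" for kap
    proof (intro iffI subsetI ballI)
      fix e assume blk: "\<forall>C\<in>?P. \<forall>u\<in>C. \<forall>v\<in>C. kap u = kap v" and e: "e \<in> S"
      obtain u v where uv: "e = {u, v}" using doubleton[of e] e S by auto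
      with e fin have "u \<in> verts G" "(u, v) \<in> reach S"
        by (auto simp: finite_graph_def intro: reach_step[OF reach_refl])
      then have "reach S `` {u} \<in> ?P" "u \<in> reach S `` {u}" "v \<in> reach S `` {u}"
        by (auto simp: components_def)
      then have "kap u = kap v" by (rule blk[rule_format])
      with e S uv show "e \<in> mono kap" by (auto simp: mono_iff)
    next
      fix C u v assume S': "S \<subseteq> mono kap" and C: "C \<in> ?P" "u \<in> C" "v \<in> C"
      have inv: "kap a = kap b" if "(a, b) \<in> reach S" for a b
        using that by (rule reach_invariant) (use S' mono_iff in blast)
      show "kap u = kap v"
      proof -
        obtain w where "C = reach S `` {w}" using C(1) by (auto simp: components_def)
        with C(2,3) have "kap w = kap u" "kap w = kap v" by (auto intro!: inv)
        then show ?thesis by simp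
      qed
    qed
    then have colorings: "{kap \<in> block_colorings ?P. image_mset kap (mset_set (\<Union>?P)) = m} =
        {kap \<in> K. S \<subseteq> mono kap}"
      unfolding block_colorings_def U K_def by auto
    have "mfps_monom_sum (block_colorings ?P) (\<lambda>kap. image_mset kap (mset_set (\<Union>?P))) =
        (\<Prod>C\<in>?P. power_sum (card C))"
    proof (rule monom_sum_block_colorings)
      fix C assume C: "C \<in> ?P"
      then have "C \<subseteq> verts G" using U by auto
      with C V show "finite C \<and> C \<noteq> {}"
        using finite_subset component_nonempty by blast
    next
      fix C D assume "C \<in> ?P" "D \<in> ?P" "C \<noteq> D"
      then show "C \<inter> D = {}" using components_disjoint by blast
    qed (rule finite_components[OF fin])
    from this[symmetric] show ?thesis
      by (simp only: mfps_coeff_monom_sum colorings)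
  qed
  have "mfps_coeff (chromatic_symmetric_function G) m = of_nat (card {kap \<in> K. mono kap = {}})"
    unfolding chromatic_symmetric_function_def mfps_coeff_monom_sum proper ..
  also have "\<dots> = (\<Sum>kap\<in>K. if mono kap = {} then 1 else 0)"
    using \<open>finite K\<close> by (simp add: sum.If_cases Int_def)
  \<comment> \<open>Inclusion-exclusion: the alternating sum over sets of monochromatic edges is the
    indicator of a proper coloring. The next step makes the range independent of
    \<open>kap\<close>.\<close>
  also have "\<dots> = (\<Sum>kap\<in>K. \<Sum>S\<in>Pow (mono kap). (- 1) ^ card S)"
    using E by (intro sum.cong refl alternating_sum_Pow[symmetric])
      (rule finite_subset[OF mono_edges])
  also have "\<dots> = (\<Sum>kap\<in>K. \<Sum>S\<in>Pow (edges G). if S \<subseteq> mono kap then (- 1) ^ card S else 0)"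
    using E by (intro sum.cong refl sum.mono_neutral_cong_left) (use mono_edges in auto)
  also have "\<dots> = (\<Sum>S\<in>Pow (edges G). \<Sum>kap\<in>K. if S \<subseteq> mono kap then (- 1) ^ card S else 0)"
    by (rule sum.swap)
  also have "\<dots> = (\<Sum>S\<in>Pow (edges G). (- 1) ^ card S * of_nat (card {kap \<in> K. S \<subseteq> mono kap}))"
    using \<open>finite K\<close> by (simp add: sum.If_cases Int_def mult.commute)
  also have "\<dots> = mfps_coeff (\<Sum>S\<in>Pow (edges G).
      mfps_const ((- 1) ^ card S) * (\<Prod>C\<in>components (verts G, S). power_sum (card C))) m"
    by (simp add: mfps_coeff_sum blocks)
  finally show "mfps_coeff (chromatic_symmetric_function G) m =
    mfps_coeff (\<Sum>S\<in>Pow (edges G).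
      mfps_const ((- 1) ^ card S) * (\<Prod>C\<in>components (verts G, S). power_sum (card C))) m" .
qed

section \<open>Component sizes as partitions, and the coefficients of the chromatic symmetric
  function\<close>

definition component_sizes :: "'v graph \<Rightarrow> nat list" where
  "component_sizes G = rev (sorted_list_of_multiset (image_mset card (mset_set (components G))))"

lemma mset_component_sizes:
  "mset (component_sizes G) = image_mset card (mset_set (components G))"
  by (simp add: component_sizes_def)

lemma length_component_sizes: "length (component_sizes G) = card (components G)"
  by (metis mset_component_sizes size_image_mset size_mset size_mset_set)

lemma prod_list_component_sizes:
  "(\<Prod>k\<leftarrow>component_sizes G. f k) = (\<Prod>C\<in>components G. f (card C))"
proof -
  have "(\<Prod>k\<leftarrow>component_sizes G. f k) = prod_mset (mset (map f (component_sizes G)))"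
    by (simp only: prod_mset_prod_list)
  then show ?thesis
    by (simp add: mset_component_sizes prod_unfold_prod_mset image_mset.compositionality o_def)
qed

lemma sum_list_component_sizes:
  "(\<Sum>k\<leftarrow>component_sizes G. f k) = (\<Sum>C\<in>components G. f (card C))"
proof -
  have "(\<Sum>k\<leftarrow>component_sizes G. f k) = sum_mset (mset (map f (component_sizes G)))"
    by (simp only: sum_mset_sum_list)
  then show ?thesis
    by (simp add: mset_component_sizes sum_unfold_sum_mset image_mset.compositionality o_def)
qed

lemma component_sizes_partition:
  assumes "finite_graph G"
  shows "component_sizes G \<in> partitions (card (verts G))"
proof -
  have fin: "finite C" if "C \<in> components G" for C
    using that assms Union_components[OF assms] finite_subset
    by (metis Union_upper finite_graph_def)
  have "sum_list (component_sizes G) = (\<Sum>C\<in>components G. card C)"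
    using sum_list_component_sizes[of "\<lambda>k. k" G] by simp
  also have "\<dots> = card (\<Union>(components G))"
    using components_disjoint[where G = G] fin
    by (intro card_Union_disjoint[symmetric]) (auto simp: pairwise_def disjnt_def)
  finally have "sum_list (component_sizes G) = card (verts G)"
    by (simp add: Union_components[OF assms])
  moreover have "set (component_sizes G) = card ` components G"
    using finite_components[OF assms]
    by (metis finite_set_mset_mset_set mset_component_sizes set_image_mset set_mset_mset)
  then have "\<forall>k\<in>set (component_sizes G). 0 < k"
    using fin component_nonempty[of _ G] by (auto simp: card_gt_0_iff)
  \<comment> \<open>This is the purpose of \<open>rev\<close>:
    \<open>sorted_list_of_multiset\<close> is ascending, whereas partitions are listed in descending
    order.\<close>
  moreover have "sorted_wrt (\<ge>) (component_sizes G)"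
    by (simp add: component_sizes_def sorted_wrt_rev)
  ultimately show ?thesis by (simp add: partitions_def)
qed

text \<open>Group the expansion by the partition of component sizes; uniqueness of power sum
  coefficients then identifies them.\<close>

lemma chrom_coeff_eq:
  assumes G: "finite_graph G"
  shows "chrom_coeff G lam =
    (\<Sum>S | S \<subseteq> edges G \<and> component_sizes (verts G, S) = lam. (- 1) ^ card S)"
proof -
  let ?ty = "\<lambda>S. component_sizes (verts G, S)"
  let ?c = "\<lambda>lam. \<Sum>S | S \<subseteq> edges G \<and> ?ty S = lam. (- 1) ^ card S :: rat"
  have E: "finite (Pow (edges G))" using finite_graph_finite_edges[OF G] by simp
  have ty: "?ty S \<in> partitions (card (verts G))" if "S \<in> Pow (edges G)" for S
    using component_sizes_partition[of "(verts G, S)"] G that by (auto simp: finite_graph_def)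
  have "power_sum_coeffs (card (verts G)) (chromatic_symmetric_function G) = ?c"
  proof (rule power_sum_coeffs_eqI)
    fix lam assume "lam \<notin> partitions (card (verts G))"
    then have "{S. S \<subseteq> edges G \<and> ?ty S = lam} = {}" using ty by auto
    then show "?c lam = 0" by (simp only: sum.empty)
  next
    have "chromatic_symmetric_function G =
        (\<Sum>S\<in>Pow (edges G). mfps_const ((- 1) ^ card S) * power_sum_part (?ty S))"
      by (simp add: chromatic_symmetric_function_expansion[OF G] power_sum_part_def
          prod_list_component_sizes)
    also have "\<dots> = (\<Sum>lam\<in>partitions (card (verts G)). \<Sum>S\<in>{S \<in> Pow (edges G). ?ty S = lam}.
        mfps_const ((- 1) ^ card S) * power_sum_part (?ty S))"
      using ty by (intro sum.group[symmetric] E finite_partitions) auto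
    also have "\<dots> = (\<Sum>lam\<in>partitions (card (verts G)). mfps_const (?c lam) * power_sum_part lam)"
      by (intro sum.cong refl mfps_eqI) (simp add: mfps_coeff_sum sum_distrib_right)
    finally show "chromatic_symmetric_function G =
        (\<Sum>lam\<in>partitions (card (verts G)). mfps_const (?c lam) * power_sum_part lam)" .
  qed
  then show ?thesis by (simp add: chrom_coeff_def)
qed

text \<open>Since the edge sets are partitioned by their component sizes, a weighted sum of
  coefficients becomes one sum over all edge sets, without reference to partitions.\<close>

lemma sum_mult_chrom_coeff:
  assumes G: "finite_graph G"
  shows "(\<Sum>lam\<in>partitions (card (verts G)). h lam * chrom_coeff G lam) =
    (\<Sum>S\<in>Pow (edges G). (- 1) ^ card S * h (component_sizes (verts G, S)))"
proof -
  have "h lam * chrom_coeff G lam =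
      (\<Sum>S\<in>{S \<in> Pow (edges G). component_sizes (verts G, S) = lam}.
        (- 1) ^ card S * h (component_sizes (verts G, S)))" for lam
    unfolding chrom_coeff_eq[OF G] mult.commute[of "h lam"] sum_distrib_right
    by (rule sum.cong) auto
  then have "(\<Sum>lam\<in>partitions (card (verts G)). h lam * chrom_coeff G lam) =
      (\<Sum>lam\<in>partitions (card (verts G)).
        \<Sum>S\<in>{S \<in> Pow (edges G). component_sizes (verts G, S) = lam}.
          (- 1) ^ card S * h (component_sizes (verts G, S)))"
    by (simp only:)
  also have "\<dots> = (\<Sum>S\<in>Pow (edges G). (- 1) ^ card S * h (component_sizes (verts G, S)))"
  proof (rule sum.group[OF _ finite_partitions])
    show "(\<lambda>S. component_sizes (verts G, S)) ` Pow (edges G) \<subseteq> partitions (card (verts G))"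
    proof (rule image_subsetI)
      fix S assume "S \<in> Pow (edges G)"
      with G have "finite_graph (verts G, S)" by (auto simp: finite_graph_def)
      from component_sizes_partition[OF this]
      show "component_sizes (verts G, S) \<in> partitions (card (verts G))" by simp
    qed
  qed (simp add: finite_graph_finite_edges[OF G])
  finally show ?thesis .
qed

section \<open>The subtree polynomial\<close>

text \<open>Here \<open>k\<close> is the number of edges of a subtree with \<open>i = Suc k\<close>
  vertices, \<open>f\<close> the number of further edges in \<open>S\<close>, and \<open>l\<close>
  the number of components of \<open>S\<close>. The binomial in \<open>sigma_coeff\<close> becomes
  \<open>f\<close> over \<open>f - r\<close>, and the parity of \<open>k\<close> cancels between the
  two signs.\<close>

lemma sigma_weight:
  assumes "n = Suc k + j + r" "l + (k + f) = n"
  shows "(- 1) ^ (k + f) * ((- 1) powi (int n - int j - 1)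
      * int_binomial (int n - int (Suc k) - int l + 1) (int j - int l + 1)) =
    (- 1) ^ r * ((- 1) ^ f * of_nat (f choose r))"
proof -
  have exps: "int n - int j - 1 = int (k + r)" "int n - int (Suc k) - int l + 1 = int f"
    "int j - int l + 1 = int f - int r"
    using assms by auto
  have "int_binomial (int f) (int f - int r) = of_nat (f choose r)"
  \<comment> \<open>For \<open>r > f\<close> the lower argument is negative, so
    \<open>int_binomial\<close> is 0 by convention and agrees with
    \<open>f choose r\<close>.\<close>
  proof (cases "r \<le> f")
    case True
    then have "nat (int f - int r) = f - r" by auto
    with True show ?thesis
      by (simp add: int_binomial_def binomial_gbinomial[symmetric] binomial_symmetric[of r f])
  qed (simp add: int_binomial_def)
  moreover have "(- 1) ^ (k + f) * (- 1) ^ (k + r) = ((- 1) ^ r * (- 1) ^ f :: rat)"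
    by (simp add: power_add ac_simps)
  ultimately show ?thesis
    unfolding exps power_int_of_nat by (metis mult.assoc)
qed

lemma sigma_coeff_component_sizes:
  "sigma_coeff n (component_sizes G) i j =
    (-1) powi (int n - int j - 1)
     * int_binomial (int n - int i - int (card (components G)) + 1) (int j - int (card (components G)) + 1)
     * (\<Sum>C\<in>components G. if card C = i then 1 else 0)"
proof -
  have parts: "(\<Sum>s<length lam. if lam ! s = i then 1 else 0) = (\<Sum>k\<leftarrow>lam. if k = i then 1 else 0 :: rat)"
    for lam
    by (simp add: sum_list_sum_nth atLeast0LessThan)
  show ?thesis
    by (simp only: sigma_coeff_def parts)
      (simp only: length_component_sizes sum_list_component_sizes)
qed

text \<open>After \<open>sigma_weight\<close> only an alternating sum over \<open>Pow M\<close>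
  remains. The three bounds come from the same edge count and place the exponents of
  \<open>H\<close> in the range of the double sum of the theorem.\<close>

lemma sum_edge_sets_containing_subtree:
  fixes T :: "'v graph"
  assumes T: "finite_tree T" and H: "H \<in> subtrees T"
    and n: "n = card (verts T)" and i: "card (verts H) = i" and j: "j \<le> n - i"
  shows "(\<Sum>S | S \<subseteq> edges T \<and> verts H \<in> components (verts T, S).
      (- 1) ^ card S * ((- 1) powi (int n - int j - 1)
        * int_binomial (int n - int i - int (card (components (verts T, S))) + 1)
            (int j - int (card (components (verts T, S))) + 1))) =
    (if boundary_degree T (verts H) = j then 1 else 0)"
    and "1 \<le> i" "i \<le> n" "boundary_degree T (verts H) \<le> n - i"
proof -
  have fin: "finite_graph T" and conn: "connected_graph T" and forest: "forest (edges T)"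
    using T finite_tree_forest[of T] by (auto simp: finite_tree_def)
  have finH: "finite_graph H" "connected_graph H" and sub: "edges H \<subseteq> edges T" "verts H \<subseteq> verts T"
    using H by (auto simp: subtrees_def subgraph_def)
  have E: "finite (edges T)" using finite_graph_finite_edges[OF fin] .
  define B where "B = boundary T (verts H)"
  \<comment> \<open>The edges that may be added freely while \<open>H\<close> stays a component;
    their number is \<open>n - i\<close> minus the boundary degree.\<close>
  define M where "M = edges T - edges H - B"
  have B: "B \<subseteq> edges T" "card B = boundary_degree T (verts H)"
    by (auto simp: B_def boundary_def boundary_degree_def)
  have "B \<inter> edges H = {}"
  proof -
    have "e \<inter> verts H = e \<and> card e = 2" if "e \<in> edges H" for e
      using that finH(1) by (auto simp: finite_graph_def)
    then show ?thesis by (force simp: B_def boundary_def)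
  qed
  have cardT: "Suc (card (edges T)) = n"
    using card_edges_connected_forest[OF fin conn forest] n by simp
  have cardH: "Suc (card (edges H)) = i"
    using card_edges_connected_forest[OF finH forest_subset[OF forest sub(1)]] i by simp
  have finite: "finite (edges H)" "finite B" "finite M"
    using E sub(1) B(1) finite_subset by (auto simp: M_def)
  have "edges T = edges H \<union> B \<union> M"
    using sub(1) B(1) by (auto simp: M_def)
  also have "card \<dots> = card (edges H) + card B + card M"
    using \<open>B \<inter> edges H = {}\<close> finite
    by (subst card_Un_disjoint; auto simp: M_def card_Un_disjoint Int_commute)
  finally have card_sum: "card (edges T) = card (edges H) + card B + card M" .
  show "1 \<le> i" "i \<le> n" "boundary_degree T (verts H) \<le> n - i"
    using cardT cardH card_sum B(2) by auto
  \<comment> \<open>The value that \<open>card M\<close> takes when the boundary degree is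
    \<open>j\<close>. The subtractions do not truncate, since \<open>i \<le> n\<close> and
    \<open>j \<le> n - i\<close>.\<close>
  define r where "r = n - i - j"
  have n_eq: "n = Suc (card (edges H)) + j + r"
    using cardT cardH card_sum j by (auto simp: r_def)
  have "(\<Sum>S | S \<subseteq> edges T \<and> verts H \<in> components (verts T, S).
      (- 1) ^ card S * ((- 1) powi (int n - int j - 1)
        * int_binomial (int n - int i - int (card (components (verts T, S))) + 1)
            (int j - int (card (components (verts T, S))) + 1))) =
      (\<Sum>F\<in>Pow M. (- 1) ^ r * ((- 1) ^ card F * of_nat (card F choose r)))"
  proof (rule sum.reindex_bij_witness[of _ "\<lambda>F. edges H \<union> F" "\<lambda>S. S - edges H"])
    fix S assume "S \<in> {S. S \<subseteq> edges T \<and> verts H \<in> components (verts T, S)}"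
    then have S: "S \<subseteq> edges T" "edges H \<subseteq> S" "S \<inter> B = {}"
      using verts_subtree_component_iff[OF fin forest H, of S] by (auto simp: B_def)
    then show "edges H \<union> (S - edges H) = S" "S - edges H \<in> Pow M"
      by (auto simp: M_def)
    have "finite_graph (verts T, S)"
      using S(1) fin by (auto simp: finite_graph_def)
    then have "card (components (verts T, S)) + card S = n"
      using card_components_forest forest_subset[OF forest S(1)] n by blast
    moreover have "card S = card (edges H) + card (S - edges H)"
      using S finite(1) by (simp add: card_Diff_subset card_mono finite_subset[OF S(1) E])
    ultimately show "(- 1) ^ r * ((- 1) ^ card (S - edges H) * of_nat (card (S - edges H) choose r)) =
      (- 1) ^ card S * ((- 1) powi (int n - int j - 1)
        * int_binomial (int n - int i - int (card (components (verts T, S))) + 1)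
            (int j - int (card (components (verts T, S))) + 1))"
      using sigma_weight[OF n_eq, of "card (components (verts T, S))" "card (S - edges H)"] cardH
      by simp
  next
    fix F assume "F \<in> Pow M"
    then have F: "F \<subseteq> edges T" "F \<inter> edges H = {}" "F \<inter> B = {}"
      by (auto simp: M_def)
    then show "edges H \<union> F - edges H = F" by auto
    have "edges H \<union> F \<subseteq> edges T" using F sub by auto
    then show "edges H \<union> F \<in> {S. S \<subseteq> edges T \<and> verts H \<in> components (verts T, S)}"
      using verts_subtree_component_iff[OF fin forest H, of "edges H \<union> F"] F
        \<open>B \<inter> edges H = {}\<close> by (auto simp: B_def)
  qed
  also have "\<dots> = (- 1) ^ r * (if card M = r then (- 1) ^ r else 0)"
    by (simp add: sum_distrib_left[symmetric] alternating_sum_choose_card[OF finite(3)])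
  also have "\<dots> = (if card M = r then 1 else 0)"
    by (simp add: power_add[symmetric] mult_2[symmetric])
  also have "card M = r \<longleftrightarrow> boundary_degree T (verts H) = j"
    using card_sum cardT cardH j B(2) by (auto simp: r_def)
  finally show "(\<Sum>S | S \<subseteq> edges T \<and> verts H \<in> components (verts T, S).
      (- 1) ^ card S * ((- 1) powi (int n - int j - 1)
        * int_binomial (int n - int i - int (card (components (verts T, S))) + 1)
            (int j - int (card (components (verts T, S))) + 1))) =
    (if boundary_degree T (verts H) = j then 1 else 0)" .
qed

text \<open>Double counting of pairs of an edge set and one of its components of size
  \<open>i\<close>: first by edge set, then by the subtree on that component.\<close>

lemma sum_sigma_chrom_coeff:
  assumes T: "finite_tree T" and n: "n = card (verts T)" and j: "j \<le> n - i"
  shows "(\<Sum>lam\<in>partitions n. sigma_coeff n lam i j * chrom_coeff T lam) =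
    of_nat (card {H \<in> subtrees T. card (verts H) = i \<and> boundary_degree T (verts H) = j})"
proof -
  have fin: "finite_graph T" and forest: "forest (edges T)"
    using T finite_tree_forest[of T] by (auto simp: finite_tree_def)
  have fin': "finite (Pow (edges T))" "finite (subtrees T)"
    using finite_graph_finite_edges[OF fin] finite_subtrees[OF fin] by auto
  define w :: "'a set set \<Rightarrow> rat" where
    "w = (\<lambda>S. (- 1) ^ card S * ((- 1) powi (int n - int j - 1)
        * int_binomial (int n - int i - int (card (components (verts T, S))) + 1)
            (int j - int (card (components (verts T, S))) + 1)))"
  \<comment> \<open>The sum over components is written over all subtrees with an indicator, so that
    its range no longer depends on \<open>S\<close> and the sums can be swapped.\<close>
  have comps: "(\<Sum>C\<in>components (verts T, S). if card C = i then 1 else 0) =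
      (\<Sum>H\<in>subtrees T. if verts H \<in> components (verts T, S) \<and> card (verts H) = i then 1 else 0 :: rat)"
    if "S \<in> Pow (edges T)" for S
  proof -
    let ?A = "{H \<in> subtrees T. verts H \<in> components (verts T, S)}"
    have "inj_on verts ?A"
      using inj_on_verts_subtrees[OF fin forest] by (rule inj_on_subset) auto
    then have "(\<Sum>C\<in>components (verts T, S). if card C = i then 1 else 0) =
        (\<Sum>H\<in>?A. if card (verts H) = i then 1 else 0 :: rat)"
      using that by (subst components_conv_subtrees[OF fin]) (auto simp: sum.reindex)
    also have "\<dots> = (\<Sum>H\<in>subtrees T.
        if verts H \<in> components (verts T, S) \<and> card (verts H) = i then 1 else 0)"
      using fin'(2) by (intro sum.mono_neutral_cong_left) auto
    finally show ?thesis .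
  qed
  have "(\<Sum>lam\<in>partitions n. sigma_coeff n lam i j * chrom_coeff T lam) =
      (\<Sum>S\<in>Pow (edges T). w S * (\<Sum>C\<in>components (verts T, S). if card C = i then 1 else 0))"
    unfolding n sum_mult_chrom_coeff[OF fin]
    by (simp add: sigma_coeff_component_sizes w_def n mult.assoc)
  also have "\<dots> = (\<Sum>S\<in>Pow (edges T). \<Sum>H\<in>subtrees T.
      if verts H \<in> components (verts T, S) \<and> card (verts H) = i then w S else 0)"
    by (intro sum.cong refl) (simp add: comps sum_distrib_left if_distrib cong: if_cong)
  also have "\<dots> = (\<Sum>H\<in>subtrees T. \<Sum>S\<in>Pow (edges T).
      if verts H \<in> components (verts T, S) \<and> card (verts H) = i then w S else 0)"
    by (rule sum.swap)
  also have "\<dots> = (\<Sum>H\<in>subtrees T.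
      if card (verts H) = i \<and> boundary_degree T (verts H) = j then 1 else 0)"
  proof (rule sum.cong[OF refl])
    fix H assume H: "H \<in> subtrees T"
    show "(\<Sum>S\<in>Pow (edges T).
        if verts H \<in> components (verts T, S) \<and> card (verts H) = i then w S else 0) =
      (if card (verts H) = i \<and> boundary_degree T (verts H) = j then 1 else 0)"
    proof (cases "card (verts H) = i")
      case True
      have "(\<Sum>S\<in>Pow (edges T). if verts H \<in> components (verts T, S) then w S else 0) =
          (\<Sum>S | S \<subseteq> edges T \<and> verts H \<in> components (verts T, S). w S)"
        using fin'(1) by (intro sum.mono_neutral_cong_right) auto
      then show ?thesis
        using sum_edge_sets_containing_subtree(1)[OF T H n True j] True by (simp add: w_def)
    qed simp
  qed
  also have "\<dots> = of_nat (card {H \<in> subtrees T. card (verts H) = i \<and> boundary_degree T (verts H) = j})"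
    using fin'(2) by (simp add: sum.If_cases Int_def)
  finally show ?thesis .
qed

theorem theorem4p2:
  fixes T :: "'v graph" and n :: nat
  assumes "finite_tree T" and "card (verts T) = n"
  shows "subtree_poly T =
    (\<Sum>i = 1..n. \<Sum>j = 0..n - i. poly_x ^ i * poly_y ^ j *
       poly_const (\<Sum>lam\<in>partitions n. sigma_coeff n lam i j * chrom_coeff T lam))"
proof -
  let ?I = "SIGMA i:{1..n}. {0..n - i}"
  let ?t = "\<lambda>H. (card (verts H), boundary_degree T (verts H))"
  have n: "n = card (verts T)" using assms(2) by simp
  have "finite (subtrees T)"
    using assms(1) finite_subtrees[of T] by (auto simp: finite_tree_def)
  \<comment> \<open>Each subtree has its exponent pair among the indices of the double sum, so
    grouping by exponents loses none.\<close>
  have range: "?t ` subtrees T \<subseteq> ?I"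
    using sum_edge_sets_containing_subtree(2-4)[OF assms(1) _ n refl le0] by auto
  have of_nat: "of_nat k = poly_const (of_nat k)" for k
    by (simp add: of_nat_poly)
  have "(\<Sum>i = 1..n. \<Sum>j = 0..n - i. poly_x ^ i * poly_y ^ j *
       poly_const (\<Sum>lam\<in>partitions n. sigma_coeff n lam i j * chrom_coeff T lam)) =
    (\<Sum>i = 1..n. \<Sum>j = 0..n - i. poly_x ^ i * poly_y ^ j * of_nat (card {H \<in> subtrees T. ?t H = (i, j)}))"
    by (intro sum.cong refl) (simp add: sum_sigma_chrom_coeff[OF assms(1) n] of_nat)
  also have "\<dots> = (\<Sum>(i, j)\<in>?I. poly_x ^ i * poly_y ^ j * of_nat (card {H \<in> subtrees T. ?t H = (i, j)}))"
    by (rule sum.Sigma) auto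
  \<comment> \<open>The number of subtrees with exponents \<open>p\<close> is turned back into a sum
    of equal monomials over them.\<close>
  also have "\<dots> = (\<Sum>p\<in>?I. \<Sum>H\<in>{H \<in> subtrees T. ?t H = p}.
      poly_x ^ card (verts H) * poly_y ^ boundary_degree T (verts H))"
    by (intro sum.cong refl) (auto simp: mult.commute)
  also have "\<dots> = subtree_poly T"
    unfolding subtree_poly_def using \<open>finite (subtrees T)\<close> range by (intro sum.group) auto
  finally show ?thesis ..
qed

end
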